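(* Let $0<|q|<1$ and let $n=1,2,3,\dots$. Then $$\vartheta_2(0,q)^{4n^2}=\left\{4^{n(n+1)}\prod_{r=1}^{2n-1}(r!)^{-1}\right\}\cdot\det\left(C_{2(r+s-1)-1}\right)_{1\le r,s\le n}$$ and $$\vartheta_2(0,q^{1/2})^{4n(n+1)}=\left\{2^{n(4n+5)}\prod_{r=1}^{2n}(r!)^{-1}\right\}\cdot\det\left(D_{2(r+s-1)+1}\right)_{1\le r,s\le n},$$ where, for $i=1,2,3,\dots$, $$C_{2i-1}\equiv C_{2i-1}(q):=\sum_{r=1}^{\infty}\frac{(2r-1)^{2i-1}q^{2r-1}}{1-q^{2(2r-1)}},\qquad D_{2i+1}\equiv D_{2i+1}(q):=\sum_{r=1}^{\infty}\frac{r^{2i+1}q^r}{1-q^{2r}}.$$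
   Context: $\vartheta_2(0,q):=\sum_{j=-\infty}^{\infty}q^{(j+1/2)^2}=q^{1/4}\sum_{j=-\infty}^{\infty}q^{j(j+1)}$. The powers occurring are independent of the choice of fractional powers of $q$: $\vartheta_2(0,q)^{4n^2}=q^{n^2}\bigl(\sum_{j\in\mathbb Z}q^{j(j+1)}\bigr)^{4n^2}$ and $\vartheta_2(0,q^{1/2})^{4n(n+1)}=q^{n(n+1)/2}\bigl(\sum_{j\in\mathbb Z}q^{j(j+1)/2}\bigr)^{4n(n+1)}$. *)

theory Defs
  imports
    "HOL-Analysis.Complex_Transcendental"
    "HOL-Analysis.Infinite_Sum"
    "Jordan_Normal_Form.Determinant"
begin

text \<open>
  The theta null value \<open>\<vartheta>\<^sub>2(0,q)\<close>. Fractional powers of \<open>q\<close> are principal ones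
  (\<^const>\<open>powr\<close>). Only powers of \<open>theta2 q\<close> whose exponent is a multiple of 4 are used;
  the lemmas below show that these do not depend on the branch.
\<close>
definition theta2 :: "complex \<Rightarrow> complex" where
  "theta2 q = (\<Sum>\<^sub>\<infinity>j::int. q powr ((of_int j + 1/2)\<^sup>2))"

lemma theta2_altdef:
  assumes "q \<noteq> 0"
  shows "theta2 q = q powr (1/4) * (\<Sum>\<^sub>\<infinity>j::int. q powi (j * (j + 1)))"
proof -
  have "q powr ((of_int j + 1/2)\<^sup>2) = q powr (1/4) * q powi (j * (j + 1))" for j :: int
  proof -
    have eq: "(of_int j + 1/2 :: complex)\<^sup>2 = 1/4 + of_int (j * (j + 1))"
      by (simp add: power2_eq_square field_simps)
    show ?thesis
      unfolding eq powr_add using assms by (subst complex_powr_of_int) auto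
  qed
  then show ?thesis
    by (simp add: theta2_def infsum_cmult_right')
qed

lemma powr_quarter_power4:
  assumes "q \<noteq> (0::complex)"
  shows "(q powr (1/4)) ^ 4 = q"
proof -
  have "(q powr (1/4)) ^ 4 = exp (of_nat 4 * (1/4 * Ln q))"
    using assms by (simp only: powr_def exp_of_nat_mult if_False)
  then show ?thesis using assms by simp
qed

lemma theta2_power_4:
  assumes "q \<noteq> 0"
  shows "theta2 q ^ (4 * m) = q ^ m * (\<Sum>\<^sub>\<infinity>j::int. q powi (j * (j + 1))) ^ (4 * m)"
  using assms powr_quarter_power4[OF assms]
  by (simp add: theta2_altdef power_mult_distrib power_mult)

text \<open>Replacing \<open>q powr (1/4)\<close> by any other fourth root \<open>w\<close> of \<open>q\<close> gives the same powers.\<close>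
lemma theta2_power_4_any_root:
  assumes "q \<noteq> 0" "w ^ 4 = q"
  shows "(\<Sum>\<^sub>\<infinity>j::int. w powi ((2 * j + 1)\<^sup>2)) ^ (4 * m) = theta2 q ^ (4 * m)"
proof -
  have w: "w \<noteq> 0" using assms by auto
  have "w powi ((2 * j + 1)\<^sup>2) = w * q powi (j * (j + 1))" for j :: int
  proof -
    have eq: "(2 * j + 1)\<^sup>2 = 1 + 4 * (j * (j + 1))"
      by (simp add: power2_eq_square algebra_simps)
    have "w powi (4 * (j * (j + 1))) = (w powi 4) powi (j * (j + 1))"
      by (rule power_int_mult)
    also have "w powi 4 = q" using assms(2) by simp
    finally show ?thesis unfolding eq using w by (simp add: power_int_add)
  qed
  then have "(\<Sum>\<^sub>\<infinity>j::int. w powi ((2 * j + 1)\<^sup>2)) = w * (\<Sum>\<^sub>\<infinity>j::int. q powi (j * (j + 1)))"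
    by (simp add: infsum_cmult_right')
  moreover have "w ^ (4 * m) = q ^ m"
    using assms(2) by (simp add: power_mult)
  ultimately show ?thesis
    using theta2_power_4[OF assms(1), of m] by (simp only: power_mult_distrib)
qed

text \<open>For any square root \<open>p\<close> of \<open>q\<close>, the second kind of power depends on \<open>q\<close> only.\<close>
lemma theta2_sqrt_power:
  assumes "q \<noteq> 0" "p\<^sup>2 = q"
  shows "theta2 p ^ (4 * n * (n + 1)) =
    q ^ (n * (n + 1) div 2) * (\<Sum>\<^sub>\<infinity>j::int. q powi (j * (j + 1) div 2)) ^ (4 * n * (n + 1))"
proof -
  have p: "p \<noteq> 0" using assms by auto
  have "p powi (j * (j + 1)) = q powi (j * (j + 1) div 2)" for j :: int
  proof -
    have eq: "j * (j + 1) = 2 * (j * (j + 1) div 2)" by simp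
    have "p powi (j * (j + 1)) = p powi (2 * (j * (j + 1) div 2))"
      using eq by (rule arg_cong)
    also have "\<dots> = (p powi 2) powi (j * (j + 1) div 2)"
      by (rule power_int_mult)
    also have "p powi 2 = q" using assms(2) by simp
    finally show ?thesis .
  qed
  moreover have "p ^ (n * (n + 1)) = q ^ (n * (n + 1) div 2)"
  proof -
    have eq: "n * (n + 1) = 2 * (n * (n + 1) div 2)" by simp
    have "p ^ (n * (n + 1)) = p ^ (2 * (n * (n + 1) div 2))"
      using eq by (rule arg_cong)
    also have "\<dots> = (p\<^sup>2) ^ (n * (n + 1) div 2)" by (rule power_mult)
    finally show ?thesis using assms(2) by simp
  qed
  ultimately show ?thesis
    using theta2_power_4[OF p, of "n * (n + 1)"] by (simp only: mult.assoc)
qed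

text \<open>
  The subscript is the exponent in the numerator. The natural-number subtraction
  \<open>2 * r - 1\<close> is exact because \<open>r \<ge> 1\<close>.
\<close>
definition lambert_C :: "nat \<Rightarrow> complex \<Rightarrow> complex" where
  "lambert_C k q =
     (\<Sum>\<^sub>\<infinity>r\<in>{1::nat..}. of_nat (2 * r - 1) ^ k * q ^ (2 * r - 1) / (1 - q ^ (2 * (2 * r - 1))))"

definition lambert_D :: "nat \<Rightarrow> complex \<Rightarrow> complex" where
  "lambert_D k q = (\<Sum>\<^sub>\<infinity>r\<in>{1::nat..}. of_nat r ^ k * q ^ r / (1 - q ^ (2 * r)))"

text \<open>
  The matrix \<open>(a r s)\<close> with \<open>1 \<le> r, s \<le> n\<close>; entries of \<^const>\<open>mat\<close> are indexed from 0.
\<close>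
definition mat1 :: "nat \<Rightarrow> (nat \<Rightarrow> nat \<Rightarrow> 'a) \<Rightarrow> 'a mat" where
  "mat1 n a = mat n n (\<lambda>(i, j). a (i + 1) (j + 1))"

end

theory Submission
  imports "HOL-Complex_Analysis.Complex_Analysis" Defs
begin

text \<open>
  For a rapidly decaying \<open>u :: int \<Rightarrow> complex\<close> let \<open>moments u\<close> be the formal power series of
  \<open>\<Sum>\<^sub>k u\<^sub>k exp (k z)\<close>; then differentiation multiplies \<open>u\<^sub>k\<close> by \<open>k\<close> and products become
  convolutions. Let \<open>F\<close> be the series with \<open>u\<^sub>k = q\<^sup>k / (1 - q\<^sup>2\<^sup>k)\<close> on odd \<open>k\<close> (up to scaling, the
  Jacobi function \<open>sn\<close>). Its Taylor coefficients are the \<open>C\<^sub>2\<^sub>i\<^sub>-\<^sub>1\<close>, those of \<open>F\<^sup>2\<close> are the \<open>D\<^sub>2\<^sub>i\<^sub>+\<^sub>1\<close> for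
  \<open>q\<^sup>2\<close>, and evaluating the convolutions by telescoping gives \<open>F'' = 8 F\<^sup>3 + \<alpha> F\<close>. Hence the second
  derivative acts tridiagonally on the odd powers and on the even powers of \<open>F\<close>, and the Hankel
  determinants are products of the off-diagonal entries: monomials in \<open>C\<^sub>1\<close> times factorials.
  The unknown \<open>\<alpha>\<close> only enters the diagonal and drops out.

  It remains to show \<open>\<vartheta>\<^sub>2(0,q)\<^sup>4 = 16 C\<^sub>1(q)\<close>. Convolution identities for the sums of
  \<open>q\<^sup>k / (1 + q\<^sup>2\<^sup>k)\<close> over even and over odd \<open>k\<close> show that they satisfy the same recurrences under
  \<open>q \<mapsto> q\<^sup>2\<close> as the squares of \<open>\<vartheta>\<^sub>3\<close> and \<open>\<vartheta>\<^sub>2\<close>. For real \<open>q\<close> these recurrences have only one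
  positive solution with the right limit, as in the arithmetic-geometric mean, and analytic
  continuation extends the identity to the unit disc.
\<close>

section \<open>Sums over the integers\<close>

text \<open>Differentiating the power series term by term and multiplying by \<open>x\<close> brings
  down one more factor \<open>k\<close>, so the exponent grows by induction inside the disc of
  convergence.\<close>

lemma summable_power_times_geometric:
  fixes x :: real
  assumes "norm x < 1"
  shows "summable (\<lambda>k. of_nat k ^ n * x ^ k)"
  using assms
proof (induction n arbitrary: x)
  case (Suc n)
  have "summable (\<lambda>k. diffs (\<lambda>k. of_nat k ^ n) k * x ^ k)"
    by (rule termdiff_converges[OF Suc.prems]) (use Suc.IH in auto)
  then have "summable (\<lambda>k. x * (diffs (\<lambda>k. of_nat k ^ n) k * x ^ k))"
    by (rule summable_mult)
  then have "summable (\<lambda>k. of_nat (Suc k) ^ Suc n * x ^ Suc k)"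
    by (simp add: diffs_def mult_ac del: of_nat_Suc)
  then show ?case by (subst (asm) summable_Suc_iff)
qed (auto intro: summable_geometric)

lemma summable_on_intI:
  fixes f :: "int \<Rightarrow> 'a::{comm_monoid_add, t2_space, topological_comm_monoid_add}"
  assumes "(\<lambda>k. f (int k)) summable_on UNIV" "(\<lambda>k. f (- int (Suc k))) summable_on UNIV"
  shows "f summable_on UNIV"
proof -
  have 1: "f summable_on range int"
    using assms(1) by (subst summable_on_reindex) (auto simp: o_def)
  have 2: "f summable_on range (\<lambda>k. - int (Suc k))"
    using assms(2) by (subst summable_on_reindex) (auto simp: o_def inj_on_def)
  have "range int \<union> range (\<lambda>k. - int (Suc k)) = UNIV"
  proof (intro equalityI subsetI)
    fix k :: int
    show "k \<in> range int \<union> range (\<lambda>k. - int (Suc k))"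
    proof (cases k)
      case (nonneg n) then show ?thesis by auto
    next
      case (neg n) then show ?thesis by (auto intro!: rangeI)
    qed
  qed auto
  moreover have "range int \<inter> range (\<lambda>k. - int (Suc k)) = {}"
    by auto
  ultimately show ?thesis
    using summable_on_Un_disjoint[OF 1 2] by simp
qed

lemma summable_on_nat_geometric:
  fixes r :: real
  assumes "0 \<le> r" "r < 1"
  shows "(\<lambda>k. real k ^ n * r ^ k) summable_on UNIV"
  by (rule norm_summable_imp_summable_on)
     (use summable_power_times_geometric[of r n] assms in \<open>simp add: abs_mult\<close>)

lemma summable_on_int_geometric:
  fixes r :: real
  assumes "0 \<le> r" "r < 1"
  shows "(\<lambda>k::int. real_of_int \<bar>k\<bar> ^ n * r ^ nat \<bar>k\<bar>) summable_on UNIV"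
proof (rule summable_on_intI)
  show nn: "(\<lambda>k. real_of_int \<bar>int k\<bar> ^ n * r ^ nat \<bar>int k\<bar>) summable_on UNIV"
    using summable_on_nat_geometric[OF assms, of n] by simp
  have "(\<lambda>k. real k ^ n * r ^ k) summable_on range Suc"
    by (rule summable_on_subset_banach[OF summable_on_nat_geometric[OF assms, of n]]) auto
  then show "(\<lambda>k. real_of_int \<bar>- int (Suc k)\<bar> ^ n * r ^ nat \<bar>- int (Suc k)\<bar>) summable_on UNIV"
    by (subst (asm) summable_on_reindex) (auto simp: o_def nat_add_distrib add.commute)
qed

lemma has_sum_times:
  fixes f :: "'a \<Rightarrow> 'c::{real_normed_field, banach}" and g :: "'b \<Rightarrow> 'c"
  assumes f: "f abs_summable_on A" and g: "g abs_summable_on B"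
  shows "((\<lambda>(x, y). f x * g y) has_sum infsum f A * infsum g B) (A \<times> B)"
proof -
  have 1: "(\<lambda>(x, y). f x * g y) abs_summable_on A \<times> B"
    using f g by (auto simp: Infinite_Sum.abs_summable_on_Sigma_iff norm_mult infsum_cmult_right' abs_mult infsum_nonneg intro!: summable_on_cmult_right summable_on_cmult_left)
  then have s: "(\<lambda>(x, y). f x * g y) summable_on A \<times> B"
    by (rule abs_summable_summable)
  then have "infsum (\<lambda>(x, y). f x * g y) (A \<times> B) = (\<Sum>\<^sub>\<infinity>x\<in>A. \<Sum>\<^sub>\<infinity>y\<in>B. f x * g y)"
    by (rule infsum_Sigma'_banach[symmetric])
  also have "\<dots> = infsum f A * infsum g B"
    by (simp add: infsum_cmult_right' infsum_cmult_left')
  finally show "((\<lambda>(x, y). f x * g y) has_sum infsum f A * infsum g B) (A \<times> B)"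
    using s by (simp add: has_sum_iff)
qed

lemma has_sum_shift_int:
  fixes f :: "int \<Rightarrow> 'a::{comm_monoid_add, topological_space}"
  shows "((\<lambda>t. f (t + m)) has_sum S) UNIV \<longleftrightarrow> (f has_sum S) UNIV"
  by (rule has_sum_reindex_bij_witness[of _ "\<lambda>t. t - m" "\<lambda>t. t + m"]) auto

text \<open>Telescoping for a function that tends to 0 at one end and to 1 at the other. The
  summable part \<open>\<eta>\<close> cancels against its own shift; the step function leaves a
  signed count of the integers it passes.\<close>

lemma has_sum_step_shift:
  fixes \<eta> :: "int \<Rightarrow> 'a::{real_normed_field, banach}"
  assumes "\<eta> summable_on UNIV" and G: "\<And>t. G t = \<eta> t + (if t \<ge> 0 then 1 else 0)"
  shows "((\<lambda>t. G (t + m) - G t) has_sum of_int m) UNIV"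
proof -
  have e: "(\<eta> has_sum infsum \<eta> UNIV) UNIV" using assms by simp
  then have "((\<lambda>t. \<eta> (t + m)) has_sum infsum \<eta> UNIV) UNIV" by (simp add: has_sum_shift_int)
  moreover have "((\<lambda>t. - \<eta> t) has_sum - infsum \<eta> UNIV) UNIV" using e by (simp add: has_sum_uminus)
  ultimately have "((\<lambda>t. \<eta> (t + m) + - \<eta> t) has_sum infsum \<eta> UNIV + - infsum \<eta> UNIV) UNIV"
    by (rule has_sum_add)
  then have 1: "((\<lambda>t. \<eta> (t + m) - \<eta> t) has_sum 0) UNIV" by simp
  define h :: "int \<Rightarrow> 'a" where "h t = (if t + m \<ge> 0 then 1 else 0) - (if t \<ge> 0 then 1 else 0)" for t
  have 2: "(h has_sum of_int m) UNIV"
  proof (cases "m \<ge> 0")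
    case True
    show ?thesis
      by (rule has_sum_finite_neutralI[of "{-m..<0}"]) (use True in \<open>auto simp: h_def\<close>)
  next
    case False
    show ?thesis
      by (rule has_sum_finite_neutralI[of "{0..<-m}"]) (use False in \<open>auto simp: h_def sum_negf\<close>)
  qed
  show ?thesis
    using has_sum_add[OF 1 2] by (simp add: G h_def algebra_simps)
qed

lemma has_sum_odd_int:
  fixes f :: "int \<Rightarrow> 'a::{comm_monoid_add, topological_space}"
  assumes "\<And>k. even k \<Longrightarrow> f k = 0"
  shows "((\<lambda>t. f (2 * t + 1)) has_sum S) UNIV \<longleftrightarrow> (f has_sum S) UNIV"
proof -
  have "((\<lambda>t. f (2 * t + 1)) has_sum S) UNIV \<longleftrightarrow> (f has_sum S) {k. odd k}"
    by (rule has_sum_reindex_bij_witness[of _ "\<lambda>k. (k - 1) div 2" "\<lambda>t. 2 * t + 1"]) auto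
  also have "\<dots> \<longleftrightarrow> (f has_sum S) UNIV"
    by (rule has_sum_cong_neutral) (use assms in auto)
  finally show ?thesis .
qed

lemma infsum_even_fun_int:
  fixes f :: "int \<Rightarrow> 'a::{real_normed_field, banach}"
  assumes s: "f summable_on UNIV" and e: "\<And>k. f (- k) = f k" and z: "f 0 = 0"
  shows "infsum f UNIV = 2 * (\<Sum>\<^sub>\<infinity>r\<in>{1::nat..}. f (int r))"
proof -
  have "infsum f {0<..} = (\<Sum>\<^sub>\<infinity>r\<in>{1::nat..}. f (int r))"
    by (rule infsum_reindex_bij_witness[of _ int nat]) auto
  moreover have "infsum f {..<0} = infsum f {0<..}"
    by (rule infsum_reindex_bij_witness[of _ uminus uminus]) (auto simp: e)
  moreover have "infsum f ({..<0} \<union> {0<..}) = infsum f {..<0} + infsum f {0<..}"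
    by (rule infsum_Un_disjoint) (use summable_on_subset_banach[OF s] in auto)
  moreover have "infsum f ({..<0} \<union> {0<..}) = infsum f UNIV"
    by (rule infsum_cong_neutral) (use z in \<open>auto simp: not_less\<close>)
  ultimately show ?thesis by simp
qed

lemma has_sum_sum:
  fixes f :: "'i \<Rightarrow> 'b \<Rightarrow> 'a::topological_comm_monoid_add"
  assumes "finite I" "\<And>i. i \<in> I \<Longrightarrow> (f i has_sum S i) A"
  shows "((\<lambda>x. \<Sum>i\<in>I. f i x) has_sum (\<Sum>i\<in>I. S i)) A"
  using assms by (induction I rule: finite_induct) (auto intro!: has_sum_add)

text \<open>The bracket is what two step functions from a partial fraction leave over: the indicator
  of \<open>0 < s \<le> m\<close> if \<open>m \<ge> 0\<close>, and minus the indicator of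
  \<open>m < s \<le> 0\<close> otherwise. Both cases lead to the same triangular number.\<close>

lemma has_sum_gauss_int:
  "((\<lambda>s. of_int s * ((if s \<le> m then 1 else 0) + (if s > 0 then 1 else 0) - 1))
     has_sum (of_int (m * (m + 1)) / 2 :: 'a::{real_normed_field, banach})) UNIV"
proof (cases "m \<ge> 0")
  case True
  then obtain n where m: "m = int n" using nonneg_int_cases by blast
  have "(\<Sum>s\<in>{0..int n}. of_int s :: 'a) = of_int (int n * (int n + 1)) / 2"
  proof (induction n)
    case (Suc n)
    have "{0..int (Suc n)} = insert (int (Suc n)) {0..int n}" by auto
    then show ?case using Suc by (simp add: field_simps)
  qed simp
  moreover have "(\<Sum>s\<in>{0..m}. of_int s :: 'a) =
      (\<Sum>s\<in>{0..m}. of_int s * ((if s \<le> m then 1 else 0) + (if s > 0 then 1 else 0) - 1))"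
    by (rule sum.cong) auto
  ultimately show ?thesis
    by (intro has_sum_finite_neutralI[of "{0..m}"]) (use m in auto)
next
  case False
  then obtain n where m: "m = - int n" by (metis int_cases2 linorder_not_le nle_le of_nat_0_le_iff)
  have "(\<Sum>s\<in>{1 - int n..0}. - of_int s :: 'a) = of_int (int n * (int n - 1)) / 2"
  proof (induction n)
    case (Suc n)
    have "{1 - int (Suc n)..0} = insert (- int n) {1 - int n..0}" by auto
    then show ?case using Suc by (simp add: field_simps)
  qed simp
  moreover have "(\<Sum>s\<in>{m+1..0}. - of_int s :: 'a) =
      (\<Sum>s\<in>{m+1..0}. of_int s * ((if s \<le> m then 1 else 0) + (if s > 0 then 1 else 0) - 1))"
    by (rule sum.cong) auto
  ultimately show ?thesis
    by (intro has_sum_finite_neutralI[of "{m+1..0}"]) (use m False in \<open>auto simp: algebra_simps\<close>)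
qed

text \<open>Reflection turns the sum into its negative; this also covers a divergent sum, whose
  value is 0 by convention.\<close>

lemma infsum_odd_fun_int:
  fixes f :: "int \<Rightarrow> 'a::{real_normed_field, banach}"
  assumes "\<And>k. f (- k) = - f k"
  shows "infsum f UNIV = 0"
proof -
  have "infsum f UNIV = infsum (\<lambda>k. - f k) UNIV"
    by (rule infsum_reindex_bij_witness[of _ uminus uminus]) (auto simp: assms)
  then show ?thesis by (simp add: infsum_uminus)
qed

lemma has_sum_reflect_int:
  fixes f :: "int \<Rightarrow> 'a::{comm_monoid_add, topological_space}"
  shows "((\<lambda>t. f (m - t)) has_sum S) UNIV \<longleftrightarrow> (f has_sum S) UNIV"
  by (rule has_sum_reindex_bij_witness[of _ "\<lambda>t. m - t" "\<lambda>t. m - t"]) auto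

text \<open>The unweighted count for the same bracket of step functions as in
  \<open>has_sum_gauss_int\<close>.\<close>

lemma has_sum_count_int:
  "((\<lambda>t. (if t > 0 then 1 else 0) + (if t \<le> m then 1 else 0) - 1)
     has_sum (of_int m :: 'a::{real_normed_field, banach})) UNIV"
proof (cases "m \<ge> 0")
  case True
  have "(\<Sum>t\<in>{1..m}. (if t > 0 then 1 else 0) + (if t \<le> m then 1 else 0) - 1 :: 'a) = (\<Sum>t\<in>{1..m}. 1)"
    by (rule sum.cong) auto
  then show ?thesis
    using True by (intro has_sum_finite_neutralI[of "{1..m}"]) auto
next
  case False
  have "(\<Sum>t\<in>{m+1..0}. (if t > 0 then 1 else 0) + (if t \<le> m then 1 else 0) - 1 :: 'a) = (\<Sum>t\<in>{m+1..0}. - 1)"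
    by (rule sum.cong) auto
  then show ?thesis
    using False by (intro has_sum_finite_neutralI[of "{m+1..0}"]) auto
qed

section \<open>Moment series of rapidly decaying weights\<close>

text \<open>For complex terms this summability is automatically absolute, which the rearrangement in
  \<open>moments_mult\<close> uses.\<close>

definition rapid :: "(int \<Rightarrow> complex) \<Rightarrow> bool" where
  "rapid u \<longleftrightarrow> (\<forall>n. (\<lambda>k. u k * of_int k ^ n) summable_on UNIV)"

definition moments :: "(int \<Rightarrow> complex) \<Rightarrow> complex fps" where
  "moments u = Abs_fps (\<lambda>n. (\<Sum>\<^sub>\<infinity>k. u k * of_int k ^ n) / fact n)"

lemma rapidD: "rapid u \<Longrightarrow> (\<lambda>k. u k * of_int k ^ n) summable_on UNIV"
  by (simp add: rapid_def)

lemma rapidI: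
  assumes "0 \<le> r" "r < 1" and bound: "\<And>k. norm (u k) \<le> C * r ^ nat \<bar>k\<bar>"
  shows "rapid u"
  unfolding rapid_def
proof
  fix n
  have "(\<lambda>k. norm (u k * of_int k ^ n)) summable_on UNIV"
  proof (rule Infinite_Sum.abs_summable_on_comparison_test')
    show "(\<lambda>k::int. C * (real_of_int \<bar>k\<bar> ^ n * r ^ nat \<bar>k\<bar>)) summable_on UNIV"
      by (intro summable_on_cmult_right summable_on_int_geometric assms)
    fix k :: int
    have "norm (u k * of_int k ^ n) = norm (u k) * real_of_int \<bar>k\<bar> ^ n"
      by (simp add: norm_mult norm_power)
    also have "\<dots> \<le> (C * r ^ nat \<bar>k\<bar>) * real_of_int \<bar>k\<bar> ^ n"
      by (intro mult_right_mono bound) auto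
    finally show "norm (u k * of_int k ^ n) \<le> C * (real_of_int \<bar>k\<bar> ^ n * r ^ nat \<bar>k\<bar>)"
      by (simp add: mult_ac)
  qed
  then show "(\<lambda>k. u k * of_int k ^ n) summable_on UNIV"
    by (rule abs_summable_summable)
qed

lemma rapid_times_int: "rapid u \<Longrightarrow> rapid (\<lambda>k. u k * of_int k)"
  unfolding rapid_def by (auto simp: mult.assoc simp flip: power_Suc)

lemma moments_deriv: "fps_deriv (moments u) = moments (\<lambda>k. u k * of_int k)"
proof (rule fps_ext)
  fix n
  have "of_nat (Suc n) * (X / fact (Suc n)) = X / fact n" for X :: complex
    unfolding fact_Suc of_nat_mult by (simp add: divide_simps del: of_nat_Suc)
  then show "fps_nth (fps_deriv (moments u)) n = fps_nth (moments (\<lambda>k. u k * of_int k)) n"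
    by (simp add: moments_def mult.assoc del: of_nat_Suc fact_Suc)
qed

lemma moments_add: "rapid u \<Longrightarrow> rapid v \<Longrightarrow> moments (\<lambda>k. u k + v k) = moments u + moments v"
  by (rule fps_ext) (simp add: moments_def distrib_right infsum_add rapidD add_divide_distrib)

lemma moments_cmult: "moments (\<lambda>k. c * u k) = fps_const c * moments u"
  by (rule fps_ext) (simp add: moments_def mult.assoc infsum_cmult_right')

text \<open>Expanding \<open>(i + j) ^ n\<close> by the binomial theorem identifies the Cauchy
  product of the coefficients with the double sum of \<open>u i * v j * (i + j) ^ n\<close>. Summing
  this along the antidiagonals \<open>k = i + j\<close> gives the moments of the
  convolution.\<close>

lemma moments_mult:
  assumes u: "rapid u" and v: "rapid v"
  shows "moments u * moments v = moments (\<lambda>k. \<Sum>\<^sub>\<infinity>i. u i * v (k - i))"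
proof (rule fps_ext)
  fix n
  define U where "U a = (\<Sum>\<^sub>\<infinity>k. u k * of_int k ^ a)" for a
  define V where "V a = (\<Sum>\<^sub>\<infinity>k. v k * of_int k ^ a)" for a
  \<comment> \<open>This is \<open>fact n\<close> times the \<open>n\<close>-th coefficient of the
    product.\<close>
  define T where "T = (\<Sum>a\<le>n. of_nat (n choose a) * (U a * V (n - a)))"
  have "((\<lambda>p. \<Sum>a\<le>n. of_nat (n choose a) *
      (case p of (i, j) \<Rightarrow> (u i * of_int i ^ a) * (v j * of_int j ^ (n - a)))) has_sum T) (UNIV \<times> UNIV)"
    unfolding T_def U_def V_def
    by (intro has_sum_sum has_sum_cmult_right has_sum_times finite_atMost)
       (use rapidD[OF u] rapidD[OF v] in \<open>simp_all add: summable_on_iff_abs_summable_on_complex\<close>)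
  also have "(\<lambda>p. \<Sum>a\<le>n. of_nat (n choose a) *
      (case p of (i, j) \<Rightarrow> (u i * of_int i ^ a) * (v j * of_int j ^ (n - a)))) =
      (\<lambda>(i, j). u i * v j * of_int (i + j) ^ n)"
    by (auto simp: fun_eq_iff binomial_ring sum_distrib_left mult_ac intro!: sum.cong)
  finally have "((\<lambda>(i, j). u i * v j * of_int (i + j) ^ n) has_sum T) (UNIV \<times> UNIV)" .
  also have "?this \<longleftrightarrow> ((\<lambda>(k, i). u i * v (k - i) * of_int k ^ n) has_sum T) (UNIV \<times> UNIV)"
    by (rule has_sum_reindex_bij_witness[of _ "\<lambda>(k, i). (i, k - i)" "\<lambda>(i, j). (i + j, i)"]) auto
  finally have hs: "((\<lambda>(k, i). u i * v (k - i) * of_int k ^ n) has_sum T) (UNIV \<times> UNIV)" .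
  then have "T = (\<Sum>\<^sub>\<infinity>(k, i)\<in>UNIV \<times> UNIV. u i * v (k - i) * of_int k ^ n)"
    by (rule infsumI[symmetric])
  also have "\<dots> = (\<Sum>\<^sub>\<infinity>k. \<Sum>\<^sub>\<infinity>i. u i * v (k - i) * of_int k ^ n)"
    by (rule infsum_Sigma'_banach[symmetric]) (use hs in \<open>auto simp: summable_on_def\<close>)
  also have "\<dots> = (\<Sum>\<^sub>\<infinity>k. (\<Sum>\<^sub>\<infinity>i. u i * v (k - i)) * of_int k ^ n)"
    by (simp add: infsum_cmult_left')
  finally have "fps_nth (moments (\<lambda>k. \<Sum>\<^sub>\<infinity>i. u i * v (k - i))) n = T / fact n"
    by (simp add: moments_def)
  also have "\<dots> = (\<Sum>a\<le>n. (U a / fact a) * (V (n - a) / fact (n - a)))"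
    unfolding T_def sum_divide_distrib by (intro sum.cong) (auto simp: binomial_fact field_simps)
  finally show "fps_nth (moments u * moments v) n = fps_nth (moments (\<lambda>k. \<Sum>\<^sub>\<infinity>i. u i * v (k - i))) n"
    by (simp add: moments_def U_def V_def fps_mult_nth atLeast0AtMost)
qed

lemma rapid_restrict:
  assumes "rapid u" shows "rapid (\<lambda>k. if P k then u k else 0)"
  unfolding rapid_def
proof
  fix n
  have "(\<lambda>k. u k * of_int k ^ n) summable_on {k. P k}"
    by (rule summable_on_subset_banach[OF rapidD[OF assms]]) auto
  also have "?this \<longleftrightarrow> (\<lambda>k. (if P k then u k else 0) * of_int k ^ n) summable_on UNIV"
    by (rule summable_on_cong_neutral) auto
  finally show "(\<lambda>k. (if P k then u k else 0) * of_int k ^ n) summable_on UNIV" .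
qed

lemma rapid_cmult: "rapid u \<Longrightarrow> rapid (\<lambda>k. c * u k)"
  by (auto simp: rapid_def mult.assoc intro!: summable_on_cmult_right)

lemma rapid_add: "rapid u \<Longrightarrow> rapid v \<Longrightarrow> rapid (\<lambda>k. u k + v k)"
  by (auto simp: rapid_def distrib_right intro!: summable_on_add)

lemma rapid_single: "rapid (\<lambda>k. if k = a then c else 0)"
  unfolding rapid_def
proof
  fix n
  have "(\<lambda>k. (if k = a then c else 0) * of_int k ^ n) summable_on {a}" by simp
  also have "?this \<longleftrightarrow> (\<lambda>k. (if k = a then c else 0) * of_int k ^ n) summable_on UNIV"
    by (rule summable_on_cong_neutral) auto
  finally show "(\<lambda>k. (if k = a then c else 0) * of_int k ^ n) summable_on UNIV" .
qed

section \<open>Convolutions of Lambert weights\<close>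

text \<open>With \<open>q = exp (-t)\<close> this is half the hyperbolic cosecant of
  \<open>k t\<close>. At \<open>k = 0\<close> the division by zero yields 0, so the weight is odd on
  all integers.\<close>

definition lambert_weight :: "complex \<Rightarrow> int \<Rightarrow> complex" where
  "lambert_weight q k = q powi k / (1 - q powi (2 * k))"

text \<open>With \<open>q = exp (-t)\<close> this is half the hyperbolic secant of
  \<open>k t\<close>, an even function of \<open>k\<close>.\<close>

definition lambert_weight_plus :: "complex \<Rightarrow> int \<Rightarrow> complex" where
  "lambert_weight_plus q k = q powi k / (1 + q powi (2 * k))"

definition odd_part :: "(int \<Rightarrow> complex) \<Rightarrow> int \<Rightarrow> complex" where
  "odd_part u k = (if odd k then u k else 0)"

definition even_part :: "(int \<Rightarrow> complex) \<Rightarrow> int \<Rightarrow> complex" where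
  "even_part u k = (if even k then u k else 0)"

context
  fixes q :: complex
  assumes q0: "q \<noteq> 0" and q1: "norm q < 1"
begin

private abbreviation w where "w \<equiv> lambert_weight q"

private definition g :: "int \<Rightarrow> complex" where "g k = 1 / (1 - q powi (2 * k))"

text \<open>Subtracting the step function from \<open>g\<close> leaves an odd, exponentially decaying function.\<close>
private definition e :: "int \<Rightarrow> complex" where "e k = (if k = 0 then 0 else g k - (if k > 0 then 1 else 0))"

lemma powi_ne_1: "k \<noteq> 0 \<Longrightarrow> q powi k \<noteq> 1"
proof
  assume k: "k \<noteq> 0" and "q powi k = 1"
  then have "norm q powi k = 1" by (metis norm_one norm_power_int)
  moreover have "norm q powi k \<noteq> 1"
  proof (cases "k > 0")
    case True
    then have "norm q powi k = norm q ^ nat k" by (simp add: power_int_def)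
    also have "\<dots> < 1" using True q1 by (simp add: power_less_one_iff)
    finally show ?thesis by simp
  next
    case False
    have "norm q ^ nat (- k) < 1" using False k q1 by (simp add: power_less_one_iff)
    moreover have "norm q powi k = inverse (norm q ^ nat (- k))" using False k by (auto simp: power_int_def power_inverse)
    ultimately show ?thesis by auto
  qed
  ultimately show False by simp
qed

lemma norm_one_minus_ge:
  assumes "k > 0" shows "norm (1 - q powi k) \<ge> 1 - norm q"
proof -
  have "norm (q powi k) = norm q ^ nat k" using assms by (simp add: power_int_def norm_power)
  also have "\<dots> \<le> norm q ^ 1" by (rule power_decreasing) (use assms q1 in auto)
  finally show ?thesis using norm_triangle_ineq2[of 1 "q powi k"] by simp
qed

lemma lambert_weight_0: "w 0 = 0"
  by (simp add: lambert_weight_def)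

lemma lambert_weight_minus: "w (- k) = - w k"
proof (cases "k = 0")
  case False
  then have "q powi (2 * k) \<noteq> 1" by (intro powi_ne_1) auto
  moreover have "q powi (2 * k) = (q powi k) ^ 2" by (simp add: power_int_mult power2_eq_square power_int_add[symmetric] q0)
  moreover have "q powi k \<noteq> 0" using q0 by simp
  ultimately show ?thesis
    by (simp add: lambert_weight_def power_int_minus divide_simps) (auto simp: algebra_simps power2_eq_square)
qed (simp add: lambert_weight_0)

private lemma g_minus: "k \<noteq> 0 \<Longrightarrow> g (- k) = 1 - g k"
  using powi_ne_1[of "2 * k"] q0 by (simp add: g_def power_int_minus divide_simps) (auto simp: algebra_simps)

private lemma e_minus: "e (- k) = - e k"
  by (auto simp: e_def g_minus)

text \<open>Partial fractions in \<open>A\<close> and \<open>B\<close>. A product of two weights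
  becomes one weight at \<open>i + j\<close> times a sum of functions of a single index, which makes
  convolution sums computable by telescoping.\<close>

lemma lambert_weight_mult:
  assumes "i \<noteq> 0" "j \<noteq> 0" "i + j \<noteq> 0"
  shows "w i * w j = w (i + j) * (g i + g j - 1)"
proof -
  define A B where "A = q powi (2 * i)" and "B = q powi (2 * j)"
  have n: "A \<noteq> 1" "B \<noteq> 1" "A * B \<noteq> 1"
    using powi_ne_1[of "2 * i"] powi_ne_1[of "2 * j"] powi_ne_1[of "2 * (i + j)"] assms q0
    by (auto simp: A_def B_def power_int_add[symmetric] distrib_left)
  have "w i * w j = (q powi (i + j)) * (1 / ((1 - A) * (1 - B)))"
    using q0 by (simp add: lambert_weight_def A_def B_def power_int_add)
  also have "1 / ((1 - A) * (1 - B)) = (1 / (1 - A) + 1 / (1 - B) - 1) / (1 - A * B)"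
    using n by (simp add: divide_simps) (auto simp: algebra_simps)
  also have "q powi (i + j) * \<dots> = w (i + j) * (g i + g j - 1)"
    using q0 by (simp add: lambert_weight_def g_def A_def B_def power_int_add distrib_left)
  finally show ?thesis .
qed

lemma lambert_weight_bound: "norm (w k) \<le> 1 / (1 - norm q) * norm q ^ nat \<bar>k\<bar>"
proof -
  have pos: "norm (w k) \<le> 1 / (1 - norm q) * norm q ^ nat k" if "k > 0" for k
  proof -
    have "norm (w k) = norm q ^ nat k / norm (1 - q powi (2 * k))"
      using that by (simp add: lambert_weight_def norm_divide power_int_def norm_power)
    also have "\<dots> \<le> norm q ^ nat k / (1 - norm q)"
      by (rule divide_left_mono) (use norm_one_minus_ge[of "2 * k"] that q1 in \<open>auto intro!: mult_pos_pos\<close>)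
    finally show ?thesis by simp
  qed
  consider "k = 0" | "k > 0" | "k < 0" by linarith
  then show ?thesis
    using pos[of k] pos[of "- k"] q1 by cases (auto simp: lambert_weight_0 lambert_weight_minus)
qed

lemma rapid_lambert_weight: "rapid w"
  by (rule rapidI[OF _ q1 lambert_weight_bound]) auto

lemma rapid_odd_part: "rapid (odd_part w)"
  by (rule rapidI[OF _ q1, of _ "1 / (1 - norm q)"]) (use lambert_weight_bound q1 in \<open>auto simp: odd_part_def\<close>)

private lemma e_bound: "norm (e k) \<le> 1 / (1 - norm q) * norm q ^ nat \<bar>k\<bar>"
proof -
  have pos: "norm (e k) \<le> 1 / (1 - norm q) * norm q ^ nat k" if "k > 0" for k
  proof -
    have "e k = q powi k * w k"
      using that powi_ne_1[of "2 * k"] q0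
      by (simp add: e_def g_def lambert_weight_def divide_simps power_int_add[symmetric])
    then have "norm (e k) = norm q ^ nat k * norm (w k)"
      using that by (simp add: norm_mult power_int_def norm_power)
    also have "\<dots> \<le> 1 * norm (w k)"
      by (rule mult_right_mono) (use q1 in \<open>auto simp: power_le_one\<close>)
    finally show ?thesis using lambert_weight_bound[of k] that by simp
  qed
  consider "k = 0" | "k > 0" | "k < 0" by linarith
  then show ?thesis
    using pos[of k] pos[of "- k"] q1 by cases (auto simp: e_minus, simp add: e_def)
qed

private lemma rapid_e: "rapid (odd_part e)"
  by (rule rapidI[OF _ q1, of _ "1 / (1 - norm q)"]) (use e_bound q1 in \<open>auto simp: odd_part_def\<close>)

text \<open>The evaluated convolution square of \<open>odd_part w\<close>. The partial fraction
  identity breaks down for \<open>k = 0\<close>, where the sum is kept as it stands; there the first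
  summand is 0.\<close>

definition even_conv :: "int \<Rightarrow> complex" where
  "even_conv k = (if even k then of_int k / 2 * w k else 0) +
     (if k = 0 then (\<Sum>\<^sub>\<infinity>i. odd_part w i * odd_part w (- i)) else 0)"

private lemma summable_e_odd: "(\<lambda>t. e (2 * t + 1)) summable_on UNIV"
proof -
  have "(\<lambda>t. odd_part e (2 * t + 1)) summable_on UNIV"
    using rapidD[OF rapid_e, of 0] has_sum_odd_int[of "odd_part e"]
    by (simp add: summable_on_def odd_part_def[of _ "2 * _"]) (simp add: odd_part_def)
  then show ?thesis by (simp add: odd_part_def)
qed

text \<open>For even \<open>k = 2 * l\<close>, nonzero, put \<open>i = 2 * t + 1\<close>. Partial
  fractions and the reflection \<open>g (- j) = 1 - g j\<close> turn the summand into
  \<open>w k\<close> times the difference \<open>G t - G (t - l)\<close>, and these differences sum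
  to \<open>l\<close>.\<close>

lemma conv_odd_part: "(\<Sum>\<^sub>\<infinity>i. odd_part w i * odd_part w (k - i)) = even_conv k"
proof -
  consider "odd k" | "k = 0" | "even k" "k \<noteq> 0" by blast
  then show ?thesis
  proof cases
    case 1
    then have "odd_part w i * odd_part w (k - i) = 0" for i by (auto simp: odd_part_def)
    then show ?thesis unfolding even_conv_def using 1 by (simp only: infsum_0_simp) auto
  next
    case 2
    then show ?thesis by (simp add: even_conv_def lambert_weight_0)
  next
    case 3
    then obtain l where l: "k = 2 * l" by blast
    define G where "G t = g (2 * t + 1)" for t
    have "((\<lambda>t. G (t + - l) - G t) has_sum of_int (- l)) UNIV"
    proof (rule has_sum_step_shift[OF summable_e_odd])
      fix t :: int
      have "2 * t + 1 \<noteq> 0" "2 * t + 1 > 0 \<longleftrightarrow> t \<ge> 0" by presburger+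
      then show "G t = e (2 * t + 1) + (if t \<ge> 0 then 1 else 0)" by (simp add: e_def G_def)
    qed
    then have "((\<lambda>t. - w k * (G (t + - l) - G t)) has_sum - w k * of_int (- l)) UNIV"
      by (rule has_sum_cmult_right)
    also have "(\<lambda>t. - w k * (G (t + - l) - G t)) = (\<lambda>t. odd_part w (2 * t + 1) * odd_part w (k - (2 * t + 1)))"
    proof
      fix t
      have "2 * t + 1 \<noteq> 0" "k - (2 * t + 1) \<noteq> 0" using l by presburger+
      then have "w (2 * t + 1) * w (k - (2 * t + 1)) = w k * (g (2 * t + 1) + g (k - (2 * t + 1)) - 1)"
        using lambert_weight_mult[of "2 * t + 1" "k - (2 * t + 1)"] 3 by simp
      also have "g (k - (2 * t + 1)) = 1 - G (t + - l)"
        using g_minus[of "2 * t + 1 - k"] l \<open>k - (2 * t + 1) \<noteq> 0\<close> by (simp add: G_def algebra_simps)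
      finally show "- w k * (G (t + - l) - G t) = odd_part w (2 * t + 1) * odd_part w (k - (2 * t + 1))"
        using 3 by (simp add: odd_part_def G_def algebra_simps)
    qed
    finally have "((\<lambda>i. odd_part w i * odd_part w (k - i)) has_sum - w k * of_int (- l)) UNIV"
      by (subst (asm) has_sum_odd_int[of "\<lambda>i. odd_part w i * odd_part w (k - i)"]) (auto simp: odd_part_def)
    then show ?thesis using 3 l by (simp add: infsumI even_conv_def)
  qed
qed

lemma rapid_even_conv: "rapid even_conv"
proof -
  have "rapid (\<lambda>k. (if even k then 1 / 2 * (w k * of_int k) else 0) +
     (if k = 0 then (\<Sum>\<^sub>\<infinity>i. odd_part w i * odd_part w (- i)) else 0))"
    by (intro rapid_add rapid_restrict rapid_cmult rapid_times_int rapid_lambert_weight rapid_single)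
  moreover have "(\<lambda>k. (if even k then 1 / 2 * (w k * of_int k) else 0) +
     (if k = 0 then (\<Sum>\<^sub>\<infinity>i. odd_part w i * odd_part w (- i)) else 0)) = even_conv"
    by (auto simp: even_conv_def fun_eq_iff)
  ultimately show ?thesis by simp
qed

lemma moments_odd_part_square: "moments (odd_part w) ^ 2 = moments even_conv"
  by (simp add: power2_eq_square moments_mult rapid_odd_part conv_odd_part)

text \<open>In the convolution the step functions contribute the quadratic polynomial in \<open>k\<close>; the decaying
  odd remainders contribute only to the constant \<open>\<kappa>\<close>.\<close>
lemma conv_even_conv:
  obtains \<kappa> where
    "\<And>k. (\<Sum>\<^sub>\<infinity>i. odd_part w i * even_conv (k - i)) = \<kappa> * odd_part w k + 1 / 8 * (odd_part w k * of_int k * of_int k)"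
proof -
  define c0 where "c0 = (\<Sum>\<^sub>\<infinity>i. odd_part w i * odd_part w (- i))"
  define E1 where "E1 = (\<Sum>\<^sub>\<infinity>k. odd_part e k * of_int k)"
  define E2 where "E2 = (\<Sum>\<^sub>\<infinity>s. of_int s * e (2 * s))"
  have re: "rapid e" by (rule rapidI[OF _ q1 e_bound]) auto
  have e0: "((\<lambda>t. e (2 * t + 1)) has_sum 0) UNIV"
  proof -
    have "infsum (odd_part e) UNIV = 0"
      by (rule infsum_odd_fun_int) (auto simp: odd_part_def e_minus)
    then have "(odd_part e has_sum 0) UNIV"
      using rapidD[OF rapid_e, of 0] by (simp add: has_sum_iff)
    then show ?thesis
      by (subst (asm) has_sum_odd_int[symmetric]) (auto simp: odd_part_def)
  qed
  have e1: "((\<lambda>t. e (2 * t + 1) * of_int (2 * t + 1)) has_sum E1) UNIV"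
  proof -
    have "((\<lambda>k. odd_part e k * of_int k) has_sum E1) UNIV"
      using rapidD[OF rapid_e, of 1] by (simp add: E1_def)
    then show ?thesis
      by (subst (asm) has_sum_odd_int[symmetric]) (auto simp: odd_part_def)
  qed
  have e2: "((\<lambda>s. of_int s * e (2 * s)) has_sum E2) UNIV"
  proof -
    have "((\<lambda>k. e k * of_int k) summable_on {k. even k})"
      using rapidD[OF re, of 1] by (auto intro: summable_on_subset_banach)
    also have "?this \<longleftrightarrow> (\<lambda>s. e (2 * s) * of_int (2 * s)) summable_on UNIV"
      by (rule summable_on_reindex_bij_witness[of _ "\<lambda>s. 2 * s" "\<lambda>k. k div 2"]) auto
    finally have "(\<lambda>s. 1 / 2 * (e (2 * s) * of_int (2 * s))) summable_on UNIV"
      by (rule summable_on_cmult_right)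
    then show ?thesis by (simp add: E2_def mult.commute)
  qed
  \<comment> \<open>\<open>c0\<close> is the term with \<open>k - i = 0\<close>, \<open>E1\<close>
    and \<open>E2\<close> come from the decaying remainders at odd and even arguments, and
    \<open>1 / 8\<close> corrects \<open>m * (m + 1) / 2\<close> to \<open>k^2 / 8\<close> for
    \<open>k = 2 * m + 1\<close>.\<close>
  define \<kappa> where "\<kappa> = c0 - E1 / 2 + E2 - 1 / 8"
  show ?thesis
  proof (rule that[of \<kappa>])
    fix k
    show "(\<Sum>\<^sub>\<infinity>i. odd_part w i * even_conv (k - i)) = \<kappa> * odd_part w k + 1 / 8 * (odd_part w k * of_int k * of_int k)"
    proof (cases "even k")
      case True
      then have "odd_part w i * even_conv (k - i) = 0" for i
        by (auto simp: odd_part_def even_conv_def)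
      moreover have "odd_part w k = 0" using True by (simp add: odd_part_def)
      ultimately show ?thesis by (simp only: infsum_0_simp) simp
    next
      case False
      then obtain m where m: "k = 2 * m + 1" by (elim oddE)
      \<comment> \<open>The contribution of both step functions in the variable
        \<open>s = m - t\<close>; the condition \<open>t \<ge> 0\<close> becomes
        \<open>s \<le> m\<close>.\<close>
      let ?st = "\<lambda>s. of_int s * ((if s \<le> m then 1 else 0) + (if s > 0 then 1 else 0) - 1) :: complex"
      \<comment> \<open>The factor \<open>m - t\<close> equals
        \<open>k / 2 - (2 * t + 1) / 2\<close>. The part proportional to \<open>k\<close> drops out
        because \<open>e\<close> is odd.\<close>
      have 1: "((\<lambda>t. of_int (m - t) * e (2 * t + 1)) has_sum (of_int k / 2 * 0 + - 1 / 2 * E1)) UNIV"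
      proof -
        have "((\<lambda>t. of_int k / 2 * e (2 * t + 1) + - 1 / 2 * (e (2 * t + 1) * of_int (2 * t + 1)))
           has_sum (of_int k / 2 * 0 + - 1 / 2 * E1)) UNIV"
          by (intro has_sum_add has_sum_cmult_right e0 e1)
        moreover have "of_int k / 2 * x + - 1 / 2 * (x * of_int (2 * t + 1)) = of_int (m - t) * x" for x :: complex and t
          by (simp add: m field_simps)
        ultimately show ?thesis by (simp only:)
      qed
      have 2: "((\<lambda>t. of_int (m - t) * e (2 * (m - t))) has_sum E2) UNIV"
        using has_sum_reflect_int[of "\<lambda>s. of_int s * e (2 * s)" m] e2 by simp
      have 3: "((\<lambda>t. ?st (m - t)) has_sum (of_int (m * (m + 1)) / 2)) UNIV"
        using has_sum_reflect_int[of ?st m] has_sum_gauss_int[of m, where 'a = complex] by blast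
      have 4: "((\<lambda>t. if t = m then c0 else 0) has_sum c0) UNIV"
        by (rule has_sum_finite_neutralI[of "{m}"]) auto
      have "((\<lambda>t. w k * (of_int (m - t) * e (2 * t + 1) + of_int (m - t) * e (2 * (m - t)) + ?st (m - t) + (if t = m then c0 else 0)))
          has_sum w k * ((of_int k / 2 * 0 + - 1 / 2 * E1) + E2 + of_int (m * (m + 1)) / 2 + c0)) UNIV"
        by (intro has_sum_cmult_right has_sum_add 1 2 3 4)
      also have "(\<lambda>t. w k * (of_int (m - t) * e (2 * t + 1) + of_int (m - t) * e (2 * (m - t)) + ?st (m - t) + (if t = m then c0 else 0))) =
         (\<lambda>t. odd_part w (2 * t + 1) * even_conv (k - (2 * t + 1)))"
      proof
        fix t
        show "w k * (of_int (m - t) * e (2 * t + 1) + of_int (m - t) * e (2 * (m - t)) + ?st (m - t) + (if t = m then c0 else 0)) =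
           odd_part w (2 * t + 1) * even_conv (k - (2 * t + 1))"
        proof (cases "t = m")
          case True
          then show ?thesis by (simp add: m odd_part_def even_conv_def c0_def e_def)
        next
          case False
          have ne: "2 * t + 1 \<noteq> 0" "k \<noteq> 0" using m by presburger+
          have k: "2 * t + 1 + 2 * (m - t) = k" by (simp add: m)
          have "w (2 * t + 1) * w (2 * (m - t)) = w k * (g (2 * t + 1) + g (2 * (m - t)) - 1)"
            using lambert_weight_mult[of "2 * t + 1" "2 * (m - t)"] False ne unfolding k by simp
          also have "g (2 * t + 1) = e (2 * t + 1) + (if m - t \<le> m then 1 else 0)"
            using ne by (auto simp: e_def)
          also have "g (2 * (m - t)) = e (2 * (m - t)) + (if m - t > 0 then 1 else 0)"
            using False by (auto simp: e_def)
          finally have "w (2 * t + 1) * w (2 * (m - t)) =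
            w k * (e (2 * t + 1) + (if m - t \<le> m then 1 else 0) + (e (2 * (m - t)) + (if m - t > 0 then 1 else 0)) - 1)" .
          moreover have "odd_part w (2 * t + 1) * even_conv (k - (2 * t + 1)) = of_int (m - t) * (w (2 * t + 1) * w (2 * (m - t)))"
            using False by (simp add: odd_part_def even_conv_def m)
          ultimately show ?thesis using False by (simp only: if_False) (simp add: algebra_simps)
        qed
      qed
      finally have "((\<lambda>i. odd_part w i * even_conv (k - i)) has_sum
          w k * ((of_int k / 2 * 0 + - 1 / 2 * E1) + E2 + of_int (m * (m + 1)) / 2 + c0)) UNIV"
        by (subst (asm) has_sum_odd_int[of "\<lambda>i. odd_part w i * even_conv (k - i)"]) (auto simp: odd_part_def)
      then show ?thesis
        using False by (subst infsumI) (auto simp: odd_part_def \<kappa>_def m field_simps)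
    qed
  qed
qed

text \<open>By \<open>conv_even_conv\<close> the threefold convolution of the weights is
  \<open>\<kappa>\<close> times the weight plus \<open>k^2 / 8\<close> times the weight, that is,
  \<open>F^3 = \<kappa> F + F'' / 8\<close>. Solving for \<open>F''\<close> gives
  \<open>\<alpha> = - 8 \<kappa>\<close>.\<close>

lemma moments_odd_part_ode:
  obtains \<alpha> where "fps_deriv (fps_deriv (moments (odd_part w))) =
    8 * moments (odd_part w) ^ 3 + fps_const \<alpha> * moments (odd_part w)"
proof -
  let ?F = "moments (odd_part w)"
  obtain \<kappa> where \<kappa>: "\<And>k. (\<Sum>\<^sub>\<infinity>i. odd_part w i * even_conv (k - i)) =
      \<kappa> * odd_part w k + 1 / 8 * (odd_part w k * of_int k * of_int k)"
    using conv_even_conv by blast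
  have "?F ^ 3 = ?F * moments even_conv"
    by (simp add: moments_odd_part_square[symmetric] power3_eq_cube power2_eq_square)
  also have "\<dots> = moments (\<lambda>k. \<kappa> * odd_part w k + 1 / 8 * (odd_part w k * of_int k * of_int k))"
    by (simp only: moments_mult[OF rapid_odd_part rapid_even_conv] \<kappa>)
  also have "\<dots> = fps_const \<kappa> * ?F + fps_const (1 / 8) * fps_deriv (fps_deriv ?F)"
    unfolding moments_deriv moments_cmult[symmetric]
    by (intro moments_add rapid_cmult rapid_times_int rapid_odd_part)
  finally have "8 * ?F ^ 3 = 8 * (fps_const \<kappa> * ?F) + (8 * fps_const (1 / 8)) * fps_deriv (fps_deriv ?F)"
    by (simp add: distrib_left mult.assoc)
  also have "8 * fps_const (1 / 8 :: complex) = 1"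
    by (simp add: numeral_fps_const)
  finally have eq: "8 * ?F ^ 3 = 8 * (fps_const \<kappa> * ?F) + fps_deriv (fps_deriv ?F)"
    by simp
  have c: "fps_const (- 8 * \<kappa>) = - (8 * fps_const \<kappa>)"
    by (simp add: numeral_fps_const)
  have "fps_deriv (fps_deriv ?F) = 8 * ?F ^ 3 + fps_const (- 8 * \<kappa>) * ?F"
    unfolding c using eq by (simp add: algebra_simps)
  then show ?thesis by (rule that)
qed

section \<open>Taylor coefficients as Lambert series\<close>

lemma lambert_weight_of_nat: "w (int n) = q ^ n / (1 - q ^ (2 * n))"
proof -
  have "q powi (2 * int n) = q ^ (2 * n)"
    by (metis of_nat_mult of_nat_numeral power_int_of_nat)
  then show ?thesis by (simp add: lambert_weight_def)
qed

text \<open>The weight and the odd power of \<open>k\<close> are both odd functions, so the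
  two-sided sum folds to twice the sum over positive odd \<open>k\<close>.\<close>

lemma moments_odd_part_nth:
  assumes "odd n"
  shows "fact n * fps_nth (moments (odd_part w)) n = 2 * lambert_C n q"
proof -
  have "fact n * fps_nth (moments (odd_part w)) n = (\<Sum>\<^sub>\<infinity>k. odd_part w k * of_int k ^ n)"
    by (simp add: moments_def)
  also have "\<dots> = 2 * (\<Sum>\<^sub>\<infinity>r\<in>{1::nat..}. odd_part w (int r) * of_int (int r) ^ n)"
    by (rule infsum_even_fun_int)
       (use assms rapidD[OF rapid_odd_part] in \<open>auto simp: odd_part_def lambert_weight_minus\<close>)
  also have "(\<Sum>\<^sub>\<infinity>r\<in>{1::nat..}. odd_part w (int r) * of_int (int r) ^ n) = (\<Sum>\<^sub>\<infinity>r\<in>{r::nat. odd r}. w (int r) * of_int (int r) ^ n)"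
    by (rule infsum_cong_neutral) (auto simp: odd_part_def, use odd_pos in force)
  also have "\<dots> = lambert_C n q"
    unfolding lambert_C_def
    by (rule infsum_reindex_bij_witness[of _ "\<lambda>r. 2 * r - 1" "\<lambda>r. (r + 1) div 2"])
       (auto simp: lambert_weight_of_nat mult.commute elim!: oddE)
  finally show ?thesis .
qed

lemma moments_odd_part_0: "fps_nth (moments (odd_part w)) 0 = 0"
proof -
  have "(\<Sum>\<^sub>\<infinity>k. odd_part w k) = 0"
    by (rule infsum_odd_fun_int) (auto simp: odd_part_def lambert_weight_minus)
  then show ?thesis by (simp add: moments_def)
qed

text \<open>Only even \<open>k = 2 * r\<close> contribute, with weight
  \<open>r q^(2 r) / (1 - q^(4 r))\<close>; this is why the nome is squared and the exponent of
  \<open>r\<close> rises by one. Since \<open>n > 0\<close>, the unevaluated value of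
  \<open>even_conv\<close> at 0 is multiplied by 0.\<close>

lemma moments_odd_part_square_nth:
  assumes "even n" "n > 0"
  shows "fact n * fps_nth (moments (odd_part w) ^ 2) n = 2 ^ (n + 1) * lambert_D (n + 1) (q\<^sup>2)"
proof -
  have w2: "w (int b * 2) = q ^ (b * 2) / (1 - q ^ (b * 4))" for b
    using lambert_weight_of_nat[of "b * 2"] by (simp add: mult.commute mult.left_commute)
  have "fact n * fps_nth (moments (odd_part w) ^ 2) n = (\<Sum>\<^sub>\<infinity>k. even_conv k * of_int k ^ n)"
    by (simp add: moments_odd_part_square) (simp add: moments_def)
  also have "\<dots> = 2 * (\<Sum>\<^sub>\<infinity>r\<in>{1::nat..}. even_conv (int r) * of_int (int r) ^ n)"
    by (rule infsum_even_fun_int)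
       (use assms rapidD[OF rapid_even_conv] in \<open>auto simp: even_conv_def lambert_weight_minus\<close>)
  also have "(\<Sum>\<^sub>\<infinity>r\<in>{1::nat..}. even_conv (int r) * of_int (int r) ^ n) =
    (\<Sum>\<^sub>\<infinity>r\<in>{r::nat. even r \<and> r > 0}. even_conv (int r) * of_int (int r) ^ n)"
    by (rule infsum_cong_neutral) (auto simp: even_conv_def)
  also have "\<dots> = (\<Sum>\<^sub>\<infinity>r\<in>{1::nat..}. 2 ^ n * (of_nat r ^ (n + 1) * (q\<^sup>2) ^ r / (1 - (q\<^sup>2) ^ (2 * r))))"
    by (rule infsum_reindex_bij_witness[of _ "\<lambda>r. 2 * r" "\<lambda>r. r div 2"])
       (auto simp: even_conv_def w2 power_mult_distrib mult_ac simp flip: power_mult elim!: evenE)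
  also have "\<dots> = 2 ^ n * lambert_D (n + 1) (q\<^sup>2)"
    by (simp only: infsum_cmult_right' lambert_D_def)
  finally show ?thesis by simp
qed


section \<open>Convolutions of the secant weights\<close>

private abbreviation u where "u \<equiv> lambert_weight_plus q"

private definition h :: "int \<Rightarrow> complex" where "h k = 1 / (1 + q powi (2 * k))"

text \<open>The odd decaying remainder of \<open>h\<close>. Its value at 0 is set to 0 although
  \<open>h 0 = 1/2\<close>; this one half reappears as a separate term in
  \<open>conv_odd_even_plus\<close>.\<close>

private definition e' :: "int \<Rightarrow> complex" where "e' k = (if k = 0 then 0 else h k - (if k > 0 then 1 else 0))"

lemma one_plus_powi_ne_0: "1 + q powi (2 * k) \<noteq> 0"
proof
  assume "1 + q powi (2 * k) = 0"
  then have eq: "q powi (2 * k) = - 1" by (simp add: eq_neg_iff_add_eq_0 add.commute)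
  have "q powi (2 * (2 * k)) = (q powi (2 * k)) * (q powi (2 * k))"
    using q0 by (simp flip: power_int_add)
  then have "q powi (2 * (2 * k)) = 1" by (simp add: eq)
  then have "k = 0" using powi_ne_1[of "2 * (2 * k)"] by auto
  then show False using eq by simp
qed

lemma lambert_weight_plus_minus: "u (- k) = u k"
proof -
  have "q powi (2 * k) = (q powi k) ^ 2" by (simp add: power_int_mult power2_eq_square power_int_add[symmetric] q0)
  moreover have "q powi k \<noteq> 0" using q0 by simp
  moreover have "1 + q powi (2 * k) \<noteq> 0" "1 + q powi (2 * (-k)) \<noteq> 0" by (rule one_plus_powi_ne_0)+
  ultimately show ?thesis
    by (simp add: lambert_weight_plus_def power_int_minus divide_simps) (auto simp: algebra_simps power2_eq_square)
qed

private lemma h_minus: "h (- k) = 1 - h k"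
  using one_plus_powi_ne_0[of k] one_plus_powi_ne_0[of "- k"] q0
  by (simp add: h_def power_int_minus divide_simps)

private lemma e'_minus: "e' (- k) = - e' k"
  by (auto simp: e'_def h_minus)

text \<open>The partial fraction identity of \<open>lambert_weight_mult\<close> with
  \<open>A\<close> and \<open>B\<close> negated. The product \<open>A * B\<close> does not change
  sign, so two secant weights produce the cosecant weight \<open>w\<close>.\<close>

lemma lambert_weight_plus_mult:
  assumes "i + j \<noteq> 0"
  shows "u i * u j = w (i + j) * (h i + h j - 1)"
proof -
  define A B where "A = q powi (2 * i)" and "B = q powi (2 * j)"
  have n: "1 + A \<noteq> 0" "1 + B \<noteq> 0" "A * B \<noteq> 1"
    using one_plus_powi_ne_0[of i] one_plus_powi_ne_0[of j] powi_ne_1[of "2 * (i + j)"] assms q0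
    by (auto simp: A_def B_def power_int_add[symmetric] distrib_left)
  have "u i * u j = (q powi (i + j)) * (1 / ((1 + A) * (1 + B)))"
    using q0 by (simp add: lambert_weight_plus_def A_def B_def power_int_add)
  also have "1 / ((1 + A) * (1 + B)) = (1 / (1 + A) + 1 / (1 + B) - 1) / (1 - A * B)"
    using n by (simp add: divide_simps) (auto simp: algebra_simps)
  also have "q powi (i + j) * \<dots> = w (i + j) * (h i + h j - 1)"
    using q0 by (simp add: lambert_weight_def h_def A_def B_def power_int_add distrib_left)
  finally show ?thesis .
qed

lemma norm_one_plus_ge:
  assumes "k > 0" shows "norm (1 + q powi k) \<ge> 1 - norm q"
proof -
  have "norm (q powi k) = norm q ^ nat k" using assms by (simp add: power_int_def norm_power)
  also have "\<dots> \<le> norm q ^ 1" by (rule power_decreasing) (use assms q1 in auto)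
  finally show ?thesis using norm_triangle_ineq2[of 1 "- (q powi k)"] by simp
qed

lemma lambert_weight_plus_bound: "norm (u k) \<le> 1 / (1 - norm q) * norm q ^ nat \<bar>k\<bar>"
proof -
  have pos: "norm (u k) \<le> 1 / (1 - norm q) * norm q ^ nat k" if "k > 0" for k
  proof -
    have "norm (u k) = norm q ^ nat k / norm (1 + q powi (2 * k))"
      using that by (simp add: lambert_weight_plus_def norm_divide power_int_def norm_power)
    also have "\<dots> \<le> norm q ^ nat k / (1 - norm q)"
      by (rule divide_left_mono)
         (use norm_one_plus_ge[of "2 * k"] that q1 in \<open>auto intro!: mult_pos_pos simp: one_plus_powi_ne_0\<close>)
    finally show ?thesis by simp
  qed
  have zero: "norm (u 0) \<le> 1 / (1 - norm q)"
    using q1 norm_ge_zero[of q] by (simp add: lambert_weight_plus_def norm_divide divide_simps del: norm_ge_zero)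
  consider "k = 0" | "k > 0" | "k < 0" by linarith
  then show ?thesis
    using pos[of k] pos[of "- k"] zero q1 by cases (auto simp: lambert_weight_plus_minus)
qed

lemma rapid_lambert_weight_plus: "rapid u"
  by (rule rapidI[OF _ q1 lambert_weight_plus_bound]) auto

lemma rapid_odd_part_plus: "rapid (odd_part u)" and rapid_even_part_plus: "rapid (even_part u)"
  unfolding odd_part_def[abs_def] even_part_def[abs_def] by (intro rapid_restrict rapid_lambert_weight_plus)+

private lemma e'_bound: "norm (e' k) \<le> 1 / (1 - norm q) * norm q ^ nat \<bar>k\<bar>"
proof -
  have pos: "norm (e' k) \<le> 1 / (1 - norm q) * norm q ^ nat k" if "k > 0" for k
  proof -
    have "e' k = - (q powi k * u k)"
      using that one_plus_powi_ne_0[of k] q0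
      by (simp add: e'_def h_def lambert_weight_plus_def divide_simps power_int_add[symmetric])
    then have "norm (e' k) = norm q ^ nat k * norm (u k)"
      using that by (simp add: norm_mult power_int_def norm_power)
    also have "\<dots> \<le> 1 * norm (u k)"
      by (rule mult_right_mono) (use q1 in \<open>auto simp: power_le_one\<close>)
    finally show ?thesis using lambert_weight_plus_bound[of k] that by simp
  qed
  consider "k = 0" | "k > 0" | "k < 0" by linarith
  then show ?thesis
    using pos[of k] pos[of "- k"] q1 by cases (auto simp: e'_minus, simp add: e'_def)
qed

private lemma rapid_e': "rapid e'"
  by (rule rapidI[OF _ q1 e'_bound]) auto

private lemma e'_odd: "((\<lambda>t. e' (2 * t + 1)) has_sum 0) UNIV"
proof -
  have "rapid (odd_part e')" unfolding odd_part_def[abs_def] by (intro rapid_restrict rapid_e')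
  moreover have "infsum (odd_part e') UNIV = 0"
    by (rule infsum_odd_fun_int) (auto simp: odd_part_def e'_minus)
  ultimately have "(odd_part e' has_sum 0) UNIV"
    using rapidD[of "odd_part e'" 0] by (simp add: has_sum_iff)
  then show ?thesis
    by (subst (asm) has_sum_odd_int[symmetric]) (auto simp: odd_part_def)
qed

private lemma e'_even: "((\<lambda>t. e' (2 * t)) has_sum 0) UNIV"
proof -
  have "e' summable_on {k. even k}"
    using rapidD[OF rapid_e', of 0] by (auto intro: summable_on_subset_banach)
  also have "?this \<longleftrightarrow> (\<lambda>t. e' (2 * t)) summable_on UNIV"
    by (rule summable_on_reindex_bij_witness[of _ "\<lambda>s. 2 * s" "\<lambda>k. k div 2"]) auto
  finally show ?thesis
    using infsum_odd_fun_int[of "\<lambda>t. e' (2 * t)"] by (simp add: e'_minus has_sum_iff)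
qed

text \<open>For \<open>k = 2 * m + 1\<close> the odd remainders sum to 0, the step functions count
  to \<open>m\<close>, and the value \<open>h 0 = 1/2\<close> at \<open>t = m\<close> adds one half.
  The total is \<open>k / 2\<close>.\<close>

lemma conv_odd_even_plus: "(\<Sum>\<^sub>\<infinity>i. odd_part u i * even_part u (k - i)) = 1 / 2 * (odd_part w k * of_int k)"
proof (cases "even k")
  case True
  then have "odd_part u i * even_part u (k - i) = 0" for i
    by (auto simp: odd_part_def even_part_def)
  moreover have "odd_part w k = 0" using True by (simp add: odd_part_def)
  ultimately show ?thesis by (simp only: infsum_0_simp) simp
next
  case False
  then obtain m where m: "k = 2 * m + 1" by (elim oddE)
  let ?s = "\<lambda>t. (if t > 0 then 1 else 0) + (if t \<le> m then 1 else 0) - 1 :: complex"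
  have 1: "((\<lambda>t. e' (2 * (m - t))) has_sum 0) UNIV"
    using has_sum_reflect_int[of "\<lambda>t. e' (2 * t)" m] e'_even by simp
  have 2: "((\<lambda>t. ?s (m - t)) has_sum of_int m) UNIV"
    using has_sum_reflect_int[of ?s m] has_sum_count_int[of m, where 'a = complex] by blast
  have 3: "((\<lambda>t. if t = m then 1 / 2 else 0) has_sum (1 / 2 :: complex)) UNIV"
    by (rule has_sum_finite_neutralI[of "{m}"]) auto
  have "((\<lambda>t. w k * (e' (2 * t + 1) + e' (2 * (m - t)) + ?s (m - t) + (if t = m then 1 / 2 else 0)))
    has_sum w k * (0 + 0 + of_int m + 1 / 2)) UNIV"
    by (intro has_sum_cmult_right has_sum_add 1 2 3 e'_odd)
  also have "(\<lambda>t. w k * (e' (2 * t + 1) + e' (2 * (m - t)) + ?s (m - t) + (if t = m then 1 / 2 else 0))) =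
    (\<lambda>t. odd_part u (2 * t + 1) * even_part u (k - (2 * t + 1)))"
  proof
    fix t :: int
    have ne: "2 * t + 1 \<noteq> 0" "k \<noteq> 0" using m by presburger+
    have k: "2 * t + 1 + 2 * (m - t) = k" by (simp add: m)
    have "u (2 * t + 1) * u (2 * (m - t)) = w k * (h (2 * t + 1) + h (2 * (m - t)) - 1)"
      using lambert_weight_plus_mult[of "2 * t + 1" "2 * (m - t)"] ne unfolding k by simp
    also have "h (2 * t + 1) = e' (2 * t + 1) + (if m - t \<le> m then 1 else 0)"
      using ne by (auto simp: e'_def)
    also have "h (2 * (m - t)) = e' (2 * (m - t)) + (if m - t > 0 then 1 else 0) + (if t = m then 1 / 2 else 0)"
      by (auto simp: e'_def h_def)
    finally show "w k * (e' (2 * t + 1) + e' (2 * (m - t)) + ?s (m - t) + (if t = m then 1 / 2 else 0)) =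
      odd_part u (2 * t + 1) * even_part u (k - (2 * t + 1))"
      by (simp add: odd_part_def even_part_def m algebra_simps)
  qed
  finally have "((\<lambda>i. odd_part u i * even_part u (k - i)) has_sum w k * (0 + 0 + of_int m + 1 / 2)) UNIV"
    by (subst (asm) has_sum_odd_int[of "\<lambda>i. odd_part u i * even_part u (k - i)"]) (auto simp: odd_part_def)
  then show ?thesis
    using False by (subst infsumI) (auto simp: odd_part_def m field_simps)
qed

text \<open>\<open>conv_odd_even_plus\<close> says that the product of the two moment series is half
  the derivative of \<open>moments (odd_part w)\<close>. This compares constant terms.\<close>

lemma odd_sum_times_even_sum: "infsum (odd_part u) UNIV * infsum (even_part u) UNIV = lambert_C 1 q"
proof -
  have "moments (odd_part u) * moments (even_part u) = moments (\<lambda>k. 1 / 2 * (odd_part w k * of_int k))"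
    by (simp only: moments_mult[OF rapid_odd_part_plus rapid_even_part_plus] conv_odd_even_plus)
  also have "\<dots> = fps_const (1 / 2) * fps_deriv (moments (odd_part w))"
    by (simp only: moments_cmult moments_deriv)
  finally have "fps_nth (moments (odd_part u) * moments (even_part u)) 0 =
    fps_nth (fps_const (1 / 2) * fps_deriv (moments (odd_part w))) 0" by simp
  then show ?thesis
    using moments_odd_part_nth[of 1] by (simp add: moments_def fps_mult_nth_0)
qed

lemma summable_odd_part_square:
  assumes v: "\<And>i. norm (v i) \<le> 1 / (1 - norm q) * norm q ^ nat \<bar>i\<bar>"
  shows "(\<lambda>i. odd_part v i ^ 2) summable_on UNIV"
proof -
  have "rapid (\<lambda>i. odd_part v i ^ 2)"
  proof (rule rapidI[OF _ q1])
    fix i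
    have "norm (odd_part v i ^ 2) \<le> norm (v i) * norm (v i)"
      by (simp add: odd_part_def norm_mult power2_eq_square)
    also have "\<dots> \<le> (1 / (1 - norm q) * norm q ^ nat \<bar>i\<bar>) * (1 / (1 - norm q) * 1)"
    proof (intro mult_mono v)
      show "norm (v i) \<le> 1 / (1 - norm q) * 1"
        by (rule order.trans[OF v mult_left_mono]) (use q1 in \<open>auto simp: power_le_one\<close>)
    qed (use q1 in auto)
    finally show "norm (odd_part v i ^ 2) \<le> (1 / (1 - norm q)) ^ 2 * norm q ^ nat \<bar>i\<bar>"
      by (simp add: power2_eq_square mult_ac)
  qed auto
  from rapidD[OF this, of 0] show ?thesis by simp
qed

text \<open>Away from \<open>k = 0\<close> the telescoping gives the same value as for
  \<open>w\<close>. At \<open>k = 0\<close> the even weight \<open>u\<close> yields the sum of its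
  squares and the odd weight \<open>w\<close> minus the sum of its squares, which accounts for the
  correction.\<close>

lemma conv_odd_odd_plus: "(\<Sum>\<^sub>\<infinity>i. odd_part u i * odd_part u (k - i)) =
  even_conv k + (if k = 0 then (\<Sum>\<^sub>\<infinity>i. odd_part u i ^ 2 + odd_part w i ^ 2) else 0)"
proof -
  consider "odd k" | "k = 0" | "even k" "k \<noteq> 0" by blast
  then show ?thesis
  proof cases
    case 1
    then have "odd_part u i * odd_part u (k - i) = 0" for i by (auto simp: odd_part_def)
    then show ?thesis unfolding even_conv_def using 1 by (simp only: infsum_0_simp) auto
  next
    case 2
    have "(\<Sum>\<^sub>\<infinity>i. odd_part u i ^ 2 + odd_part w i ^ 2) =
      (\<Sum>\<^sub>\<infinity>i. odd_part u i ^ 2) + (\<Sum>\<^sub>\<infinity>i. odd_part w i ^ 2)"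
      by (rule infsum_add[OF summable_odd_part_square[OF lambert_weight_plus_bound] summable_odd_part_square[OF lambert_weight_bound]])
    moreover have "(\<Sum>\<^sub>\<infinity>i. odd_part w i * odd_part w (- i)) = (\<Sum>\<^sub>\<infinity>i. - (odd_part w i ^ 2))"
      by (rule infsum_cong) (auto simp: odd_part_def lambert_weight_minus power2_eq_square)
    moreover have "(\<Sum>\<^sub>\<infinity>i. odd_part u i * odd_part u (- i)) = (\<Sum>\<^sub>\<infinity>i. odd_part u i ^ 2)"
      by (rule infsum_cong) (auto simp: odd_part_def lambert_weight_plus_minus power2_eq_square)
    ultimately show ?thesis using 2 by (simp add: even_conv_def infsum_uminus)
  next
    case 3
    then obtain l where l: "k = 2 * l" by blast
    let ?s = "\<lambda>t. (if t > 0 then 1 else 0) + (if t \<le> l then 1 else 0) - 1 :: complex"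
    have 1: "((\<lambda>t. e' (2 * (l - 1 - t) + 1)) has_sum 0) UNIV"
      using has_sum_reflect_int[of "\<lambda>t. e' (2 * t + 1)" "l - 1"] e'_odd by simp
    have 2: "((\<lambda>t. ?s (t + 1)) has_sum of_int l) UNIV"
      using has_sum_shift_int[of ?s 1] has_sum_count_int[of l, where 'a = complex] by blast
    have "((\<lambda>t. w k * (e' (2 * t + 1) + e' (2 * (l - 1 - t) + 1) + ?s (t + 1)))
      has_sum w k * (0 + 0 + of_int l)) UNIV"
      by (intro has_sum_cmult_right has_sum_add 1 2 e'_odd)
    also have "(\<lambda>t. w k * (e' (2 * t + 1) + e' (2 * (l - 1 - t) + 1) + ?s (t + 1))) =
      (\<lambda>t. odd_part u (2 * t + 1) * odd_part u (k - (2 * t + 1)))"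
    proof
      fix t :: int
      have ne: "2 * t + 1 \<noteq> 0" "2 * (l - 1 - t) + 1 \<noteq> 0" by presburger+
      have k: "2 * t + 1 + (2 * (l - 1 - t) + 1) = k" by (simp add: l)
      have "u (2 * t + 1) * u (2 * (l - 1 - t) + 1) = w k * (h (2 * t + 1) + h (2 * (l - 1 - t) + 1) - 1)"
        using lambert_weight_plus_mult[of "2 * t + 1" "2 * (l - 1 - t) + 1"] 3 unfolding k by simp
      also have "h (2 * t + 1) = e' (2 * t + 1) + (if t + 1 > 0 then 1 else 0)"
        using ne by (auto simp: e'_def)
      also have "h (2 * (l - 1 - t) + 1) = e' (2 * (l - 1 - t) + 1) + (if t + 1 \<le> l then 1 else 0)"
        using ne by (auto simp: e'_def)
      also have "2 * (l - 1 - t) + 1 = k - (2 * t + 1)" by (simp add: l)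
      finally show "w k * (e' (2 * t + 1) + e' (2 * (l - 1 - t) + 1) + ?s (t + 1)) =
        odd_part u (2 * t + 1) * odd_part u (k - (2 * t + 1))"
        using 3 by (simp add: odd_part_def l algebra_simps)
    qed
    finally have "((\<lambda>i. odd_part u i * odd_part u (k - i)) has_sum w k * (0 + 0 + of_int l)) UNIV"
      by (subst (asm) has_sum_odd_int[of "\<lambda>i. odd_part u i * odd_part u (k - i)"]) (auto simp: odd_part_def)
    then show ?thesis using 3 l by (simp add: infsumI even_conv_def)
  qed
qed

text \<open>The squares of \<open>moments (odd_part u)\<close> and \<open>moments (odd_part w)\<close> differ only in the constant term
  of the weights, and \<open>moments (odd_part w)\<close> vanishes at 0.\<close>
lemma odd_sum_square:
  "infsum (odd_part u) UNIV ^ 2 = (\<Sum>\<^sub>\<infinity>i. odd_part u i ^ 2 + odd_part w i ^ 2)"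
proof -
  let ?d = "\<Sum>\<^sub>\<infinity>i. odd_part u i ^ 2 + odd_part w i ^ 2"
  have "moments (odd_part u) * moments (odd_part u) = moments (\<lambda>k. even_conv k + (if k = 0 then ?d else 0))"
    by (simp only: moments_mult[OF rapid_odd_part_plus rapid_odd_part_plus] conv_odd_odd_plus)
  also have "\<dots> = moments (odd_part w) ^ 2 + moments (\<lambda>k. if k = 0 then ?d else 0)"
    by (simp only: moments_add[OF rapid_even_conv rapid_single] moments_odd_part_square)
  finally have "fps_nth (moments (odd_part u) * moments (odd_part u)) 0 =
    fps_nth (moments (odd_part w) ^ 2 + moments (\<lambda>k. if k = 0 then ?d else 0)) 0" by simp
  then have "infsum (odd_part u) UNIV ^ 2 = (\<Sum>\<^sub>\<infinity>k::int. if k = 0 then ?d else 0)"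
    by (simp add: fps_mult_nth_0 power2_eq_square moments_odd_part_0) (simp add: moments_def)
  also have "\<dots> = ?d"
    by (rule infsumI, rule has_sum_finite_neutralI[of "{0}"]) auto
  finally show ?thesis .
qed

text \<open>The weight for \<open>q\<close> at \<open>2 * t\<close> is the weight for
  \<open>q\<^sup>2\<close> at \<open>t\<close>, so the even terms for \<open>q\<close> form the full
  sum for \<open>q\<^sup>2\<close>, which is then split by parity.\<close>

lemma even_sum_double:
  "infsum (even_part u) UNIV = infsum (even_part (lambert_weight_plus (q\<^sup>2))) UNIV
     + infsum (odd_part (lambert_weight_plus (q\<^sup>2))) UNIV"
  if rapid2: "rapid (lambert_weight_plus (q\<^sup>2))"
proof -
  let ?v = "lambert_weight_plus (q\<^sup>2)"
  have "infsum (even_part u) UNIV = infsum u {k. even k}"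
    by (rule infsum_cong_neutral) (auto simp: even_part_def)
  also have "\<dots> = infsum ?v UNIV"
  proof (rule infsum_reindex_bij_witness[of _ "\<lambda>t. 2 * t" "\<lambda>k. k div 2"])
    fix k :: int assume "k \<in> {k. even k}"
    then obtain t where k: "k = 2 * t" by auto
    have "q\<^sup>2 powi m = q powi (2 * m)" for m by (simp add: power_int_mult)
    then show "?v (k div 2) = u k" by (simp add: k lambert_weight_plus_def)
  qed auto
  also have "?v = (\<lambda>k. even_part ?v k + odd_part ?v k)"
    by (auto simp: even_part_def odd_part_def)
  also have "infsum \<dots> UNIV = infsum (even_part ?v) UNIV + infsum (odd_part ?v) UNIV"
    using rapidD[OF rapid_restrict[OF rapid2, of even], of 0] rapidD[OF rapid_restrict[OF rapid2, of odd], of 0]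
    by (intro infsum_add) (simp_all add: even_part_def odd_part_def)
  finally show ?thesis .
qed

end

section \<open>Rearrangement of double Lambert series\<close>

text \<open>With \<open>2 * a + 1 = 2 * (a + 1) - 1\<close> this is a combination of the geometric
  series in \<open>Y\<^sup>2\<close> and its derivative.\<close>

lemma odd_lambert_sums:
  fixes Y :: "'a::{real_normed_field, banach}"
  assumes "norm Y < 1"
  shows "(\<lambda>a. of_nat (2 * a + 1) * Y ^ (2 * a + 1)) sums (Y * (1 + Y\<^sup>2) / (1 - Y\<^sup>2)\<^sup>2)"
proof -
  have n: "norm (Y\<^sup>2) < 1" using assms by (simp add: norm_power power_less_one_iff)
  then have ne: "Y\<^sup>2 \<noteq> 1" by auto
  have "(\<lambda>a. Y * (2 * (of_nat (Suc a) * (Y\<^sup>2) ^ a) - (Y\<^sup>2) ^ a)) sums (Y * (2 * (1 / (1 - Y\<^sup>2)\<^sup>2) - 1 / (1 - Y\<^sup>2)))"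
    by (intro sums_mult sums_diff geometric_deriv_sums geometric_sums n)
  also have "Y * (2 * (1 / (1 - Y\<^sup>2)\<^sup>2) - 1 / (1 - Y\<^sup>2)) = Y * (1 + Y\<^sup>2) / (1 - Y\<^sup>2)\<^sup>2"
    using ne by (simp add: divide_simps) (simp add: power2_eq_square algebra_simps)
  also have "(\<lambda>a. Y * (2 * (of_nat (Suc a) * (Y\<^sup>2) ^ a) - (Y\<^sup>2) ^ a)) = (\<lambda>a. of_nat (2 * a + 1) * Y ^ (2 * a + 1))"
    by (auto simp: fun_eq_iff power_mult[symmetric] algebra_simps)
  finally show ?thesis .
qed

lemma odd_geometric_has_sum:
  fixes Q :: "'a::{real_normed_field, banach}"
  assumes "norm Q < 1"
  shows "((\<lambda>b. Q ^ ((2 * a + 1) * (2 * b + 1))) has_sum (Q ^ (2 * a + 1) / (1 - Q ^ (2 * (2 * a + 1))))) UNIV"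
proof -
  let ?r = "2 * a + 1"
  have n: "norm (Q ^ (2 * ?r)) < 1"
    unfolding norm_power by (subst power_less_one_iff) (use assms in auto)
  have "((\<lambda>b. (Q ^ (2 * ?r)) ^ b) has_sum (1 / (1 - Q ^ (2 * ?r)))) UNIV"
    by (rule norm_summable_imp_has_sum[OF _ geometric_sums[OF n]])
       (use n in \<open>auto simp: norm_power intro!: summable_geometric\<close>)
  from has_sum_cmult_right[OF this, of "Q ^ ?r"]
  show ?thesis by (simp add: power_mult[symmetric] power_add[symmetric] algebra_simps)
qed

lemma lambert_C_1_altdef:
  "lambert_C 1 Q = (\<Sum>\<^sub>\<infinity>a::nat. of_nat (2 * a + 1) * (Q ^ (2 * a + 1) / (1 - Q ^ (2 * (2 * a + 1)))))"
  unfolding lambert_C_def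
proof (rule infsum_reindex_bij_witness[of _ Suc "\<lambda>r. r - 1"])
  fix r :: nat assume "r \<in> {1..}"
  then have "2 * (r - 1) + 1 = 2 * r - 1" by auto
  then show "of_nat (2 * (r - 1) + 1) * (Q ^ (2 * (r - 1) + 1) / (1 - Q ^ (2 * (2 * (r - 1) + 1)))) =
      of_nat (2 * r - 1) ^ 1 * Q ^ (2 * r - 1) / (1 - Q ^ (2 * (2 * r - 1)))"
    by (simp only: power_one_right times_divide_eq_right)
qed auto

text \<open>Both sides are iterated sums of \<open>(2 a + 1) Q^((2 a + 1) (2 b + 1))\<close>:
  summing over \<open>a\<close> first gives the left side, over \<open>b\<close> first the right
  side.\<close>

lemma odd_double_sum:
  assumes Q: "norm (Q::complex) < 1"
  shows "(\<Sum>\<^sub>\<infinity>b::nat. Q ^ (2 * b + 1) * (1 + (Q ^ (2 * b + 1))\<^sup>2) / (1 - (Q ^ (2 * b + 1))\<^sup>2)\<^sup>2) = lambert_C 1 Q"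
proof -
  define f :: "nat \<Rightarrow> nat \<Rightarrow> complex" where "f a b = of_nat (2 * a + 1) * Q ^ ((2 * a + 1) * (2 * b + 1))" for a b
  have inner: "((\<lambda>b. f a b) has_sum of_nat (2 * a + 1) * (Q ^ (2 * a + 1) / (1 - Q ^ (2 * (2 * a + 1))))) UNIV" for a
    unfolding f_def by (intro has_sum_cmult_right odd_geometric_has_sum Q)
  have inner2: "(\<Sum>\<^sub>\<infinity>a. f a b) = Q ^ (2 * b + 1) * (1 + (Q ^ (2 * b + 1))\<^sup>2) / (1 - (Q ^ (2 * b + 1))\<^sup>2)\<^sup>2" for b
  proof -
    have n: "norm (Q ^ (2 * b + 1)) < 1" using Q by (simp add: norm_power power_less_one_iff del: power_Suc)
    have n': "norm (norm (Q ^ (2 * b + 1))) < 1" using n by simp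
    have eq: "f a b = of_nat (2 * a + 1) * (Q ^ (2 * b + 1)) ^ (2 * a + 1)" for a
      unfolding f_def power_mult[symmetric] by (simp only: mult.commute)
    have "summable (\<lambda>a. norm (f a b))"
      using odd_lambert_sums[OF n', THEN sums_summable]
      by (simp add: eq norm_mult norm_power del: of_nat_add of_nat_mult of_nat_Suc power_Suc)
    then show ?thesis
      using odd_lambert_sums[OF n] by (intro infsumI norm_summable_imp_has_sum) (simp_all only: eq)
  qed
  \<comment> \<open>Absolute convergence licenses the exchange; the inner sums of norms are again
    geometric series.\<close>
  have "(\<lambda>(a, b). norm (f a b)) summable_on UNIV \<times> UNIV"
  proof (rule summable_on_SigmaI)
    fix a :: nat
    have "((\<lambda>b. real (2 * a + 1) * norm Q ^ ((2 * a + 1) * (2 * b + 1))) has_sum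
        real (2 * a + 1) * (norm Q ^ (2 * a + 1) / (1 - norm Q ^ (2 * (2 * a + 1))))) UNIV"
      by (intro has_sum_cmult_right odd_geometric_has_sum) (use Q in auto)
    then show "((\<lambda>b. case (a, b) of (a, b) \<Rightarrow> norm (f a b)) has_sum
        real (2 * a + 1) * (norm Q ^ (2 * a + 1) / (1 - norm Q ^ (2 * (2 * a + 1))))) UNIV"
      by (simp add: f_def norm_mult norm_power del: of_nat_add of_nat_mult of_nat_Suc)
  next
    have "(\<lambda>k. real k ^ 1 * norm Q ^ k) summable_on range (\<lambda>a. 2 * a + 1)"
      by (rule summable_on_subset_banach[OF summable_on_nat_geometric]) (use Q in auto)
    then have "(\<lambda>a. real (2 * a + 1) * norm Q ^ (2 * a + 1)) summable_on UNIV"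
      by (subst (asm) summable_on_reindex) (auto simp: o_def inj_on_def)
    then have s: "(\<lambda>a. 1 / (1 - norm Q) * (real (2 * a + 1) * norm Q ^ (2 * a + 1))) summable_on UNIV"
      by (rule summable_on_cmult_right)
    show "(\<lambda>a. real (2 * a + 1) * (norm Q ^ (2 * a + 1) / (1 - norm Q ^ (2 * (2 * a + 1))))) summable_on UNIV"
    proof (rule summable_on_comparison_test[OF s])
      fix a :: nat
      have "norm Q ^ (2 * (2 * a + 1)) \<le> norm Q ^ 1"
        by (rule power_decreasing) (use Q in auto)
      then have "norm Q ^ (2 * a + 1) / (1 - norm Q ^ (2 * (2 * a + 1))) \<le> norm Q ^ (2 * a + 1) / (1 - norm Q)"
        using Q by (intro divide_left_mono) (auto intro!: mult_pos_pos)
      then have "real (2 * a + 1) * (norm Q ^ (2 * a + 1) / (1 - norm Q ^ (2 * (2 * a + 1))))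
         \<le> real (2 * a + 1) * (norm Q ^ (2 * a + 1) / (1 - norm Q))"
        by (rule mult_left_mono) auto
      then show "real (2 * a + 1) * (norm Q ^ (2 * a + 1) / (1 - norm Q ^ (2 * (2 * a + 1))))
         \<le> 1 / (1 - norm Q) * (real (2 * a + 1) * norm Q ^ (2 * a + 1))"
        by simp
      define D where "D = norm Q ^ (2 * (2 * a + 1))"
      have "D \<le> 1" unfolding D_def by (rule power_le_one) (use Q in auto)
      then show "0 \<le> real (2 * a + 1) * (norm Q ^ (2 * a + 1) / (1 - norm Q ^ (2 * (2 * a + 1))))"
        unfolding D_def[symmetric] by simp
    qed
  qed simp
  then have "(\<lambda>p. norm (case p of (a, b) \<Rightarrow> f a b)) summable_on UNIV \<times> UNIV"
    by (simp only: case_prod_unfold)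
  then have "(\<lambda>(a, b). f a b) summable_on UNIV \<times> UNIV"
    by (rule abs_summable_summable)
  then have "(\<Sum>\<^sub>\<infinity>a. \<Sum>\<^sub>\<infinity>b. f a b) = (\<Sum>\<^sub>\<infinity>b. \<Sum>\<^sub>\<infinity>a. f a b)"
    by (rule infsum_swap_banach)
  also have "(\<Sum>\<^sub>\<infinity>a. \<Sum>\<^sub>\<infinity>b. f a b) = lambert_C 1 Q"
    by (simp only: infsumI[OF inner] lambert_C_1_altdef)
  finally show ?thesis by (simp only: inner2)
qed

text \<open>With \<open>Y = q^r\<close>, the squares of the two weights add up to the summand of
  \<open>odd_double_sum\<close> for \<open>Q = q\<^sup>2\<close>, up to a factor 2; another 2 comes
  from folding the sum over \<open>k\<close> and \<open>- k\<close>.\<close>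

lemma odd_sum_square_lambert:
  assumes q0: "q \<noteq> 0" and q1: "norm q < 1"
  shows "infsum (odd_part (lambert_weight_plus q)) UNIV ^ 2 = 4 * lambert_C 1 (q\<^sup>2)"
proof -
  let ?f = "\<lambda>i. odd_part (lambert_weight_plus q) i ^ 2 + odd_part (lambert_weight q) i ^ 2"
  have n2: "norm (q\<^sup>2) < 1" using q1 by (simp add: norm_power power_less_one_iff)
  have "infsum (odd_part (lambert_weight_plus q)) UNIV ^ 2 = infsum ?f UNIV"
    by (rule odd_sum_square[OF q0 q1])
  also have "\<dots> = 2 * (\<Sum>\<^sub>\<infinity>r\<in>{1::nat..}. ?f (int r))"
  proof (rule infsum_even_fun_int)
    show "?f summable_on UNIV"
      by (intro summable_on_add summable_odd_part_square[OF q0 q1] lambert_weight_plus_bound[OF q0 q1] lambert_weight_bound[OF q0 q1])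
  qed (auto simp: odd_part_def lambert_weight_plus_minus[OF q0 q1] lambert_weight_minus[OF q0 q1])
  also have "(\<Sum>\<^sub>\<infinity>r\<in>{1::nat..}. ?f (int r)) = (\<Sum>\<^sub>\<infinity>r\<in>{r::nat. odd r}. ?f (int r))"
    by (rule infsum_cong_neutral) (auto simp: odd_part_def, use odd_pos in force)
  also have "\<dots> = (\<Sum>\<^sub>\<infinity>b::nat. 2 * ((q\<^sup>2) ^ (2 * b + 1) * (1 + ((q\<^sup>2) ^ (2 * b + 1))\<^sup>2) / (1 - ((q\<^sup>2) ^ (2 * b + 1))\<^sup>2)\<^sup>2))"
  proof (rule infsum_reindex_bij_witness[of _ "\<lambda>b. 2 * b + 1" "\<lambda>r. r div 2"])
    fix r :: nat assume "r \<in> {r. odd r}"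
    then obtain b where b: "r = 2 * b + 1" by (auto elim: oddE)
    define Y where "Y = q ^ r"
    have Y1: "q powi int r = Y" by (simp add: Y_def)
    moreover have "q powi (2 * int r) = Y\<^sup>2"
      using power_int_mult[of q "int r" 2] Y1 by (simp add: mult.commute)
    moreover have "(q\<^sup>2) ^ (2 * b + 1) = Y\<^sup>2"
      unfolding Y_def b power_mult[symmetric] by (simp only: mult.commute)
    ultimately have Y: "q powi int r = Y" "q powi (2 * int r) = Y\<^sup>2" "(q\<^sup>2) ^ (2 * b + 1) = Y\<^sup>2" by blast+
    have "2 * int r \<noteq> 0" using b by simp
    from powi_ne_1[OF q0 q1 this] one_plus_powi_ne_0[OF q0 q1, of "int r"]
    have "1 - Y\<^sup>2 \<noteq> 0" "1 + Y\<^sup>2 \<noteq> 0" unfolding Y by simp_all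
    moreover have "1 - (Y\<^sup>2)\<^sup>2 = (1 - Y\<^sup>2) * (1 + Y\<^sup>2)" by (simp add: power2_eq_square algebra_simps)
    ultimately have "(Y / (1 + Y\<^sup>2))\<^sup>2 + (Y / (1 - Y\<^sup>2))\<^sup>2 = 2 * (Y\<^sup>2 * (1 + (Y\<^sup>2)\<^sup>2) / (1 - (Y\<^sup>2)\<^sup>2)\<^sup>2)"
      by (simp add: power_mult_distrib power_divide divide_simps) (simp add: power2_eq_square algebra_simps)
    then have "?f (int r) = 2 * (Y\<^sup>2 * (1 + (Y\<^sup>2)\<^sup>2) / (1 - (Y\<^sup>2)\<^sup>2)\<^sup>2)"
      using b unfolding odd_part_def lambert_weight_def lambert_weight_plus_def Y by simp
    moreover have "r div 2 = b" using b by simp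
    ultimately show "2 * ((q\<^sup>2) ^ (2 * (r div 2) + 1) * (1 + ((q\<^sup>2) ^ (2 * (r div 2) + 1))\<^sup>2) / (1 - ((q\<^sup>2) ^ (2 * (r div 2) + 1))\<^sup>2)\<^sup>2) = ?f (int r)"
      by (simp only: Y)
  qed auto
  also have "\<dots> = 2 * lambert_C 1 (q\<^sup>2)"
    by (simp only: infsum_cmult_right' odd_double_sum[OF n2])
  finally show ?thesis by simp
qed

section \<open>The fourth power of the theta function\<close>

text \<open>Uniqueness in the style of the arithmetic-geometric mean: a bound \<open>c > 1\<close> on both quotients is
  inherited from index \<open>m + 1\<close> by index \<open>m\<close>, and far out it holds because the limits agree.\<close>
lemma agm_ratio_bound:
  fixes a b a' b' x :: "nat \<Rightarrow> real"
  assumes pos: "\<And>m. a m > 0" "\<And>m. b m > 0" "\<And>m. a' m > 0" "\<And>m. b' m > 0" "\<And>m. x m \<ge> 0"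
    and A: "\<And>m. a m = a (Suc m) + x m * b (Suc m)" "\<And>m. a' m = a' (Suc m) + x m * b' (Suc m)"
    and B: "\<And>m. (b m)\<^sup>2 = 4 * a (Suc m) * b (Suc m)" "\<And>m. (b' m)\<^sup>2 = 4 * a' (Suc m) * b' (Suc m)"
    and lim: "a \<longlonglongrightarrow> 1" "a' \<longlonglongrightarrow> 1" "b \<longlonglongrightarrow> 4" "b' \<longlonglongrightarrow> 4"
  shows "b 0 \<le> b' 0"
proof -
  have step: "b 0 \<le> c * b' 0" if c: "c > 1" for c
  proof -
    have "(\<lambda>m. c * a' m - a m) \<longlonglongrightarrow> c * 1 - 1" "(\<lambda>m. c * b' m - b m) \<longlonglongrightarrow> c * 4 - 4"
      by (intro tendsto_intros lim)+
    then have "eventually (\<lambda>m. c * a' m - a m > 0 \<and> c * b' m - b m > 0) sequentially"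
      by (intro eventually_conj order_tendstoD(1)) (use c in auto)
    then obtain N where N: "c * a' N - a N > 0" "c * b' N - b N > 0"
      by (auto simp: eventually_sequentially)
    have "a m \<le> c * a' m \<and> b m \<le> c * b' m" if "m \<le> N" for m
      using that
    proof (induction rule: inc_induct)
      case base
      then show ?case using N by simp
    next
      case (step m)
      have "a (Suc m) + x m * b (Suc m) \<le> c * a' (Suc m) + x m * (c * b' (Suc m))"
        using step.IH pos(5)[of m] by (intro add_mono mult_left_mono) auto
      then have 1: "a m \<le> c * a' m" unfolding A(1)[of m] A(2)[of m] by (simp add: algebra_simps)
      have "(b m)\<^sup>2 = 4 * (a (Suc m) * b (Suc m))" by (simp add: B(1)[of m])
      also have "\<dots> \<le> 4 * ((c * a' (Suc m)) * (c * b' (Suc m)))"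
        using step.IH less_imp_le[OF pos(1)] less_imp_le[OF pos(2)] less_imp_le[OF pos(3)] less_imp_le[OF pos(4)] c
        by (intro mult_left_mono mult_mono) (auto intro!: mult_nonneg_nonneg)
      also have "\<dots> = (c * b' m)\<^sup>2"
        unfolding power_mult_distrib B(2)[of m] by (simp add: power2_eq_square[of c])
      finally have "b m \<le> c * b' m"
        using pos(4)[of m] c by (intro power2_le_imp_le[of "b m"]) auto
      with 1 show ?case by simp
    qed
    then show ?thesis by blast
  qed
  \<comment> \<open>Let the bound \<open>c\<close> decrease to 1.\<close>
  have "b 0 / b' 0 \<le> 1"
  proof (rule dense_ge)
    fix c :: real assume "c > 1"
    then show "b 0 / b' 0 \<le> c" using step[of c] pos(4)[of 0] by (simp add: divide_simps)
  qed
  then show ?thesis using pos(4)[of 0] by (simp add: divide_simps)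
qed

text \<open>Tannery's theorem. The Weierstrass M-test makes the finite partial sums converge
  uniformly in \<open>m\<close>, so the two limits can be exchanged.\<close>

lemma tendsto_infsum_dominated:
  fixes f :: "nat \<Rightarrow> 'a \<Rightarrow> 'b::banach"
  assumes M: "M summable_on A" and bound: "\<And>m x. x \<in> A \<Longrightarrow> norm (f m x) \<le> M x"
    and lim: "\<And>x. x \<in> A \<Longrightarrow> (\<lambda>m. f m x) \<longlonglongrightarrow> g x"
  shows "(\<lambda>m. infsum (f m) A) \<longlonglongrightarrow> infsum g A"
proof -
  have bound_g: "norm (g x) \<le> M x" if "x \<in> A" for x
    using tendsto_norm[OF lim[OF that]] by (rule tendsto_upperbound) (use bound that in auto)
  have u: "uniform_limit UNIV (\<lambda>X m. \<Sum>x\<in>X. f m x) (\<lambda>m. infsum (f m) A) (finite_subsets_at_top A)"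
    by (rule Weierstrass_m_test_general[OF _ M]) (use bound in auto)
  have "((\<lambda>X. \<Sum>x\<in>X. g x) \<longlongrightarrow> infsum g A) (finite_subsets_at_top A)"
  proof -
    have "g summable_on A"
      by (rule abs_summable_summable[OF Infinite_Sum.abs_summable_on_comparison_test'[OF M bound_g]])
    then show ?thesis by (simp add: has_sum_def[symmetric])
  qed
  moreover have "\<forall>\<^sub>F X in finite_subsets_at_top A. ((\<lambda>m. \<Sum>x\<in>X. f m x) \<longlongrightarrow> (\<Sum>x\<in>X. g x)) sequentially"
    by (rule eventually_finite_subsets_at_top_weakI) (auto intro!: tendsto_sum lim)
  ultimately show ?thesis
    by (intro swap_uniform_limit'[OF _ _ u]) auto
qed

text \<open>In the classical notation, \<open>\<vartheta>\<^sub>3(0,x)\<close> and \<open>x\<^bsup>-1/4\<^esup> \<vartheta>\<^sub>2(0,x)\<close>.\<close>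
definition theta_phi :: "real \<Rightarrow> real" where
  "theta_phi x = (\<Sum>\<^sub>\<infinity>j::int. x powi (j\<^sup>2))"

definition theta_psi :: "real \<Rightarrow> real" where
  "theta_psi x = (\<Sum>\<^sub>\<infinity>j::int. x powi (j * (j + 1)))"

section \<open>Doubling formulas for the theta functions\<close>

text \<open>Rotated coordinates: \<open>(s + t, s - t)\<close> runs exactly through the pairs with
  even sum, and \<open>(s + t + 1, s - t)\<close> through those with odd sum. Quadratic exponents
  separate into a part in \<open>s\<close> and a part in \<open>t\<close>.\<close>

lemma has_sum_square_lattice:
  fixes f g :: "int \<Rightarrow> real"
  shows "((\<lambda>(s, t). f (s + t) * g (s - t)) has_sum S) (UNIV \<times> UNIV) \<longleftrightarrow>
     ((\<lambda>(j, l). f j * g l) has_sum S) {(j, l). even (j + l)}"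
  and "((\<lambda>(s, t). f (s + t + 1) * g (s - t)) has_sum S) (UNIV \<times> UNIV) \<longleftrightarrow>
     ((\<lambda>(j, l). f j * g l) has_sum S) {(j, l). odd (j + l)}"
proof -
  show "((\<lambda>(s, t). f (s + t) * g (s - t)) has_sum S) (UNIV \<times> UNIV) \<longleftrightarrow>
     ((\<lambda>(j, l). f j * g l) has_sum S) {(j, l). even (j + l)}"
  proof (rule has_sum_reindex_bij_witness[of _ "\<lambda>(j, l). ((j + l) div 2, (j - l) div 2)" "\<lambda>(s, t). (s + t, s - t)"])
    fix p :: "int \<times> int" assume "p \<in> {(j, l). even (j + l)}"
    then obtain j l where jl: "p = (j, l)" "even (j + l)" by auto
    from jl(2) obtain m where "j + l = 2 * m" by (elim evenE)
    with jl have p: "p = (j, l)" "j + l = 2 * m" by auto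
    then have "(j + l) div 2 = m" "(j - l) div 2 = m - l" "m + (m - l) = j" by presburger+
    then show "(\<lambda>(s, t). (s + t, s - t)) ((\<lambda>(j, l). ((j + l) div 2, (j - l) div 2)) p) = p"
      using p by simp
  qed auto
  show "((\<lambda>(s, t). f (s + t + 1) * g (s - t)) has_sum S) (UNIV \<times> UNIV) \<longleftrightarrow>
     ((\<lambda>(j, l). f j * g l) has_sum S) {(j, l). odd (j + l)}"
  proof (rule has_sum_reindex_bij_witness[of _ "\<lambda>(j, l). ((j + l - 1) div 2, (j - l - 1) div 2)" "\<lambda>(s, t). (s + t + 1, s - t)"])
    fix p :: "int \<times> int" assume "p \<in> {(j, l). odd (j + l)}"
    then obtain j l where jl: "p = (j, l)" "odd (j + l)" by auto
    from jl(2) obtain m where "j + l = 2 * m + 1" by (elim oddE)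
    with jl have p: "p = (j, l)" "j + l = 2 * m + 1" by auto
    then have "(j + l - 1) div 2 = m" "(j - l - 1) div 2 = m - l" "m + (m - l) + 1 = j" by presburger+
    then show "(\<lambda>(s, t). (s + t + 1, s - t)) ((\<lambda>(j, l). ((j + l - 1) div 2, (j - l - 1) div 2)) p) = p"
      using p by simp
  qed auto
qed

lemma infsum_times_parity:
  fixes f g :: "int \<Rightarrow> real"
  assumes f: "f summable_on UNIV" and g: "g summable_on UNIV"
  shows "infsum f UNIV * infsum g UNIV =
    (\<Sum>\<^sub>\<infinity>(s, t)\<in>UNIV \<times> UNIV. f (s + t) * g (s - t)) +
    (\<Sum>\<^sub>\<infinity>(s, t)\<in>UNIV \<times> UNIV. f (s + t + 1) * g (s - t))"
proof -
  let ?h = "\<lambda>(j, l). f j * g l"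
  have hs: "(?h has_sum infsum f UNIV * infsum g UNIV) (UNIV \<times> UNIV)"
    by (rule has_sum_times[OF summable_on_iff_abs_summable_on_real[THEN iffD1, OF f] summable_on_iff_abs_summable_on_real[THEN iffD1, OF g]])
  then have s: "?h summable_on UNIV" by (auto simp: summable_on_def)
  have "infsum f UNIV * infsum g UNIV = infsum ?h ({(j, l). even (j + l)} \<union> {(j, l). odd (j + l)})"
  proof -
    have "{(j, l). even (j + l)} \<union> {(j, l). odd (j + l)} = (UNIV \<times> UNIV :: (int \<times> int) set)" by auto
    then show ?thesis using infsumI[OF hs] by simp
  qed
  also have "\<dots> = infsum ?h {(j, l). even (j + l)} + infsum ?h {(j, l). odd (j + l)}"
    by (rule infsum_Un_disjoint) (auto intro: summable_on_subset_banach[OF s])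
  also have "infsum ?h {(j, l). even (j + l)} = (\<Sum>\<^sub>\<infinity>(s, t)\<in>UNIV \<times> UNIV. f (s + t) * g (s - t))"
    by (rule infsum_eqI') (rule has_sum_square_lattice(1)[symmetric])
  also have "infsum ?h {(j, l). odd (j + l)} = (\<Sum>\<^sub>\<infinity>(s, t)\<in>UNIV \<times> UNIV. f (s + t + 1) * g (s - t))"
    by (rule infsum_eqI') (rule has_sum_square_lattice(2)[symmetric])
  finally show ?thesis .
qed


lemma infsum_fst_snd:
  fixes f g :: "int \<Rightarrow> real"
  assumes f: "f summable_on UNIV" and g: "g summable_on UNIV"
  shows "(\<Sum>\<^sub>\<infinity>(s, t)\<in>UNIV \<times> UNIV. f s * g t) = infsum f UNIV * infsum g UNIV"
  by (rule infsumI, rule has_sum_times[OF summable_on_iff_abs_summable_on_real[THEN iffD1, OF f] summable_on_iff_abs_summable_on_real[THEN iffD1, OF g]])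

lemma abs_le_square_int: "\<bar>j::int\<bar> \<le> j\<^sup>2"
proof (cases "j = 0")
  case False
  then have "\<bar>j\<bar> * 1 \<le> \<bar>j\<bar> * \<bar>j\<bar>" by (intro mult_left_mono) auto
  then show ?thesis by (simp add: power2_eq_square)
qed simp

lemma pronic_int_nonneg: "0 \<le> j * (j + 1 :: int)"
  by (cases "j \<ge> 0") (auto intro: mult_nonpos_nonpos)

lemma abs_le_pronic_int: "\<bar>j::int\<bar> \<le> j * (j + 1) + 1"
  using abs_le_square_int[of j] abs_le_square_int[of "j + 1"] by (simp add: power2_eq_square algebra_simps)

context
  fixes x :: real
  assumes x: "0 < x" "x < 1"
begin

text \<open>The slack of one, paid for by \<open>1 / x\<close>, is needed for the exponent
  \<open>j * (j + 1)\<close>, which is 0 at \<open>j = -1\<close>.\<close>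

lemma powi_le_geometric:
  assumes "\<bar>j\<bar> \<le> k + 1" "0 \<le> k" shows "x powi k \<le> 1 / x * x ^ nat \<bar>j\<bar>"
proof -
  have "x powi k = 1 / x * x ^ (nat k + 1)" using assms x by (simp add: power_int_def)
  also have "\<dots> \<le> 1 / x * x ^ nat \<bar>j\<bar>"
    by (rule mult_left_mono[OF power_decreasing]) (use assms x in auto)
  finally show ?thesis .
qed

lemma summable_geometric_bound: "(\<lambda>j::int. 1 / x * x ^ nat \<bar>j\<bar>) summable_on UNIV"
  using summable_on_int_geometric[of x 0] x by (intro summable_on_cmult_right) simp

lemma summable_phi: "(\<lambda>j::int. x powi (j\<^sup>2)) summable_on UNIV"
proof (rule summable_on_comparison_test[OF summable_geometric_bound])
  fix j :: int
  show "x powi (j\<^sup>2) \<le> 1 / x * x ^ nat \<bar>j\<bar>"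
    by (rule powi_le_geometric) (use abs_le_square_int[of j] in auto)
qed (use x in auto)

lemma summable_psi: "(\<lambda>j::int. x powi (j * (j + 1))) summable_on UNIV"
proof (rule summable_on_comparison_test[OF summable_geometric_bound])
  fix j :: int
  show "x powi (j * (j + 1)) \<le> 1 / x * x ^ nat \<bar>j\<bar>"
    by (rule powi_le_geometric) (use abs_le_pronic_int[of j] pronic_int_nonneg[of j] in auto)
qed (use x in auto)

end

lemma powi_square: "(x\<^sup>2) powi k = x powi (2 * k)" for x :: real
  by (simp add: power_int_mult)

text \<open>Classically, \<vartheta>3(x)^2 = \<vartheta>3(x^2)^2 + \<vartheta>2(x^2)^2. The two
  terms are the even and the odd class of \<open>infsum_times_parity\<close>.\<close>

lemma theta_phi_square:
  assumes x: "0 < x" "x < 1"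
  shows "theta_phi x ^ 2 = theta_phi (x\<^sup>2) ^ 2 + x * theta_psi (x\<^sup>2) ^ 2"
proof -
  have x0: "x \<noteq> 0" using x by simp
  have x2: "0 < x\<^sup>2" "x\<^sup>2 < 1" using x by (auto simp: power_less_one_iff)
  have 1: "x powi ((s + t)\<^sup>2) * x powi ((s - t)\<^sup>2) = (x\<^sup>2) powi (s\<^sup>2) * (x\<^sup>2) powi (t\<^sup>2)" for s t :: int
  proof -
    have "(s + t)\<^sup>2 + (s - t)\<^sup>2 = 2 * s\<^sup>2 + 2 * t\<^sup>2"
      by (simp add: power2_eq_square algebra_simps)
    then show ?thesis by (simp only: powi_square power_int_add[OF disjI1[OF x0], symmetric])
  qed
  have 2: "x powi ((s + t + 1)\<^sup>2) * x powi ((s - t)\<^sup>2) = x * ((x\<^sup>2) powi (s * (s + 1)) * (x\<^sup>2) powi (t * (t + 1)))" for s t :: int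
  proof -
    have "(s + t + 1)\<^sup>2 + (s - t)\<^sup>2 = 1 + (2 * (s * (s + 1)) + 2 * (t * (t + 1)))"
      by (simp add: power2_eq_square algebra_simps)
    then have "x powi ((s + t + 1)\<^sup>2) * x powi ((s - t)\<^sup>2) = x powi (1 + (2 * (s * (s + 1)) + 2 * (t * (t + 1))))"
      by (simp only: power_int_add[OF disjI1[OF x0], symmetric])
    then show ?thesis by (simp only: powi_square power_int_add[OF disjI1[OF x0]]) simp
  qed
  have "theta_phi x ^ 2 = (\<Sum>\<^sub>\<infinity>(s, t)\<in>UNIV \<times> UNIV. (x\<^sup>2) powi (s\<^sup>2) * (x\<^sup>2) powi (t\<^sup>2)) +
    (\<Sum>\<^sub>\<infinity>(s, t)\<in>UNIV \<times> UNIV. x * ((x\<^sup>2) powi (s * (s + 1)) * (x\<^sup>2) powi (t * (t + 1))))"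
    unfolding theta_phi_def power2_eq_square[of "infsum _ _"]
    by (subst infsum_times_parity[OF summable_phi[OF x] summable_phi[OF x]]) (simp only: 1 2)
  also have "(\<Sum>\<^sub>\<infinity>(s, t)\<in>UNIV \<times> UNIV. (x\<^sup>2) powi (s\<^sup>2) * (x\<^sup>2) powi (t\<^sup>2)) = theta_phi (x\<^sup>2) ^ 2"
    by (simp only: infsum_fst_snd[OF summable_phi[OF x2] summable_phi[OF x2]] theta_phi_def power2_eq_square[of "infsum _ _"])
  also have "(\<Sum>\<^sub>\<infinity>(s, t)\<in>UNIV \<times> UNIV. x * ((x\<^sup>2) powi (s * (s + 1)) * (x\<^sup>2) powi (t * (t + 1)))) =
     (\<Sum>\<^sub>\<infinity>p\<in>UNIV \<times> UNIV. x * (case p of (s, t) \<Rightarrow> (x\<^sup>2) powi (s * (s + 1)) * (x\<^sup>2) powi (t * (t + 1))))"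
    by (rule infsum_cong) (auto split: prod.split)
  also have "\<dots> = x * theta_psi (x\<^sup>2) ^ 2"
    by (simp only: infsum_cmult_right' infsum_fst_snd[OF summable_psi[OF x2] summable_psi[OF x2]] theta_psi_def power2_eq_square[of "infsum _ _"])
  finally show ?thesis .
qed

text \<open>Classically, \<vartheta>2(x)^2 = 2 \<vartheta>2(x^2) \<vartheta>3(x^2). Both parity
  classes contribute the same product, the second one after shifting \<open>s\<close> by 1.\<close>

lemma theta_psi_square:
  assumes x: "0 < x" "x < 1"
  shows "theta_psi x ^ 2 = 2 * theta_phi (x\<^sup>2) * theta_psi (x\<^sup>2)"
proof -
  have x0: "x \<noteq> 0" using x by simp
  have x2: "0 < x\<^sup>2" "x\<^sup>2 < 1" using x by (auto simp: power_less_one_iff)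
  have 1: "x powi ((s + t) * (s + t + 1)) * x powi ((s - t) * (s - t + 1)) = (x\<^sup>2) powi (s * (s + 1)) * (x\<^sup>2) powi (t\<^sup>2)" for s t :: int
  proof -
    have "(s + t) * (s + t + 1) + (s - t) * (s - t + 1) = 2 * (s * (s + 1)) + 2 * t\<^sup>2"
      by (simp add: power2_eq_square algebra_simps)
    then show ?thesis by (simp only: powi_square power_int_add[OF disjI1[OF x0], symmetric])
  qed
  have 2: "x powi ((s + t + 1) * (s + t + 1 + 1)) * x powi ((s - t) * (s - t + 1)) = (x\<^sup>2) powi ((s + 1)\<^sup>2) * (x\<^sup>2) powi (t * (t + 1))" for s t :: int
  proof -
    have "(s + t + 1) * (s + t + 1 + 1) + (s - t) * (s - t + 1) = 2 * (s + 1)\<^sup>2 + 2 * (t * (t + 1))"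
      by (simp add: power2_eq_square algebra_simps)
    then show ?thesis by (simp only: powi_square power_int_add[OF disjI1[OF x0], symmetric])
  qed
  have sh: "((\<lambda>s::int. (x\<^sup>2) powi ((s + 1)\<^sup>2)) has_sum theta_phi (x\<^sup>2)) UNIV"
    using has_sum_shift_int[of "\<lambda>s. (x\<^sup>2) powi (s\<^sup>2)" 1] summable_phi[OF x2] by (simp add: theta_phi_def)
  then have sh': "(\<lambda>s::int. (x\<^sup>2) powi ((s + 1)\<^sup>2)) summable_on UNIV" by (auto simp: summable_on_def)
  have "theta_psi x ^ 2 = (\<Sum>\<^sub>\<infinity>(s, t)\<in>UNIV \<times> UNIV. (x\<^sup>2) powi (s * (s + 1)) * (x\<^sup>2) powi (t\<^sup>2)) +
    (\<Sum>\<^sub>\<infinity>(s, t)\<in>UNIV \<times> UNIV. (x\<^sup>2) powi ((s + 1)\<^sup>2) * (x\<^sup>2) powi (t * (t + 1)))"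
    unfolding theta_psi_def power2_eq_square[of "infsum _ _"]
    by (subst infsum_times_parity[OF summable_psi[OF x] summable_psi[OF x]]) (simp only: 1 2)
  also have "\<dots> = theta_psi (x\<^sup>2) * theta_phi (x\<^sup>2) + theta_phi (x\<^sup>2) * theta_psi (x\<^sup>2)"
    by (simp only: infsum_fst_snd[OF summable_psi[OF x2] summable_phi[OF x2]] infsum_fst_snd[OF sh' summable_psi[OF x2]] infsumI[OF sh])
       (simp only: theta_phi_def theta_psi_def)
  finally show ?thesis by simp
qed

section \<open>Secant sums for real nomes\<close>

lemma lambert_weight_plus_of_real:
  "lambert_weight_plus (of_real s) k = of_real (s powi k / (1 + s powi (2 * k)))"
  by (simp add: lambert_weight_plus_def)

lemma infsum_lambert_weight_plus_of_real:
  assumes s: "0 < s" "s < 1"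
  shows "infsum (even_part (lambert_weight_plus (of_real s))) UNIV =
      of_real (\<Sum>\<^sub>\<infinity>k::int. if even k then s powi k / (1 + s powi (2 * k)) else 0)"
    and "infsum (odd_part (lambert_weight_plus (of_real s))) UNIV =
      of_real (\<Sum>\<^sub>\<infinity>k::int. if odd k then s powi k / (1 + s powi (2 * k)) else 0)"
proof -
  have q: "complex_of_real s \<noteq> 0" "norm (complex_of_real s) < 1" using s by auto
  have e: "(even_part (lambert_weight_plus (of_real s))) = (\<lambda>k. of_real (if even k then s powi k / (1 + s powi (2 * k)) else 0))"
    and o: "(odd_part (lambert_weight_plus (of_real s))) = (\<lambda>k. of_real (if odd k then s powi k / (1 + s powi (2 * k)) else 0))"
    by (auto simp: even_part_def odd_part_def lambert_weight_plus_of_real fun_eq_iff)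
  have hs: "infsum (\<lambda>k. complex_of_real (f k)) UNIV = of_real (infsum f UNIV)"
    if "(\<lambda>k. complex_of_real (f k)) summable_on UNIV" for f :: "int \<Rightarrow> real"
  proof -
    have "f summable_on UNIV"
      using summable_on_Re[OF that] by simp
    then show ?thesis by (intro infsumI has_sum_of_real) simp
  qed
  have "even_part (lambert_weight_plus (complex_of_real s)) summable_on UNIV"
    using rapidD[OF rapid_even_part_plus[OF q], of 0] by simp
  then show "infsum (even_part (lambert_weight_plus (of_real s))) UNIV =
      of_real (\<Sum>\<^sub>\<infinity>k::int. if even k then s powi k / (1 + s powi (2 * k)) else 0)"
    unfolding e by (rule hs)
  have "odd_part (lambert_weight_plus (complex_of_real s)) summable_on UNIV"
    using rapidD[OF rapid_odd_part_plus[OF q], of 0] by simp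
  then show "infsum (odd_part (lambert_weight_plus (of_real s))) UNIV =
      of_real (\<Sum>\<^sub>\<infinity>k::int. if odd k then s powi k / (1 + s powi (2 * k)) else 0)"
    unfolding o by (rule hs)
qed

text \<open>Real counterparts of the two complex sums. Twice the odd one will turn out to be the
  square of \<vartheta>2 at the nome \<open>s\<^sup>2\<close>.\<close>

definition even_sech_sum :: "real \<Rightarrow> real" where
  "even_sech_sum s = (\<Sum>\<^sub>\<infinity>k::int. if even k then s powi k / (1 + s powi (2 * k)) else 0)"
definition odd_sech_sum :: "real \<Rightarrow> real" where
  "odd_sech_sum s = (\<Sum>\<^sub>\<infinity>k::int. if odd k then s powi k / (1 + s powi (2 * k)) else 0)"

text \<open>The second recurrence eliminates \<open>lambert_C 1\<close> at \<open>s\<^sup>2\<close>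
  between \<open>odd_sum_square_lambert\<close> for \<open>s\<close> and
  \<open>odd_sum_times_even_sum\<close> for \<open>s\<^sup>2\<close>.\<close>

lemma sech_sum_relations:
  assumes s: "0 < s" "s < 1"
  shows "even_sech_sum s = even_sech_sum (s\<^sup>2) + odd_sech_sum (s\<^sup>2)"
    and "odd_sech_sum s ^ 2 = 4 * even_sech_sum (s\<^sup>2) * odd_sech_sum (s\<^sup>2)"
    and "of_real (odd_sech_sum s ^ 2) = 4 * lambert_C 1 (of_real (s\<^sup>2))"
proof -
  have q: "complex_of_real s \<noteq> 0" "norm (complex_of_real s) < 1" using s by auto
  have s2: "0 < s\<^sup>2" "s\<^sup>2 < 1" using s by (auto simp: power_less_one_iff)
  then have q2: "complex_of_real (s\<^sup>2) \<noteq> 0" "norm (complex_of_real (s\<^sup>2)) < 1"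
    by (simp_all add: norm_power)
  note defs = even_sech_sum_def[symmetric] odd_sech_sum_def[symmetric]
  note re = infsum_lambert_weight_plus_of_real[unfolded defs]
  have "complex_of_real (even_sech_sum s) = of_real (even_sech_sum (s\<^sup>2)) + of_real (odd_sech_sum (s\<^sup>2))"
    using even_sum_double[OF q] rapid_lambert_weight_plus[OF q2] re[OF s] re[OF s2] by simp
  then have "complex_of_real (even_sech_sum s) = of_real (even_sech_sum (s\<^sup>2) + odd_sech_sum (s\<^sup>2))" by simp
  then show "even_sech_sum s = even_sech_sum (s\<^sup>2) + odd_sech_sum (s\<^sup>2)" by (simp only: of_real_eq_iff)
  have a: "of_real (odd_sech_sum s) ^ 2 = 4 * lambert_C 1 (of_real (s\<^sup>2))"
    using odd_sum_square_lambert[OF q] re(2)[OF s] by simp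
  then show "of_real (odd_sech_sum s ^ 2) = 4 * lambert_C 1 (of_real (s\<^sup>2))" by simp
  have "complex_of_real (odd_sech_sum (s\<^sup>2)) * of_real (even_sech_sum (s\<^sup>2)) = lambert_C 1 (of_real (s\<^sup>2))"
    using odd_sum_times_even_sum[OF q2] re[OF s2] by simp
  with a have "complex_of_real (odd_sech_sum s ^ 2) = of_real (4 * even_sech_sum (s\<^sup>2) * odd_sech_sum (s\<^sup>2))"
    by (simp add: mult_ac)
  then show "odd_sech_sum s ^ 2 = 4 * even_sech_sum (s\<^sup>2) * odd_sech_sum (s\<^sup>2)" by (simp only: of_real_eq_iff)
qed

lemma sech_symmetric:
  fixes t :: real
  assumes "t > 0"
  shows "t powi (- k) / (1 + t powi (2 * - k)) = t powi k / (1 + t powi (2 * k))"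
proof -
  have "t powi (2 * k) = (t powi k)\<^sup>2" using assms by (simp add: power2_eq_square power_int_add[symmetric])
  moreover have "t powi k > 0" using assms by (rule zero_less_power_int)
  ultimately show ?thesis
    by (simp add: power_int_minus divide_simps add_pos_pos add_nonneg_eq_0_iff) (simp add: power2_eq_square algebra_simps)
qed

section \<open>Limits along iterated squaring of the nome\<close>

context
  fixes x :: real and s :: "nat \<Rightarrow> real"
  assumes x: "0 < x" "x < 1"
  defines "s \<equiv> \<lambda>m. x ^ (2 ^ m)"
begin

lemma iterated_square_props: "0 < s m" "s m < 1" "s m \<le> x" "s (Suc m) = (s m)\<^sup>2"
proof -
  show "0 < s m" "s m < 1" using x by (auto simp: s_def power_less_one_iff)
  have "x ^ 2 ^ m \<le> x ^ 1" by (rule power_decreasing) (use x in auto)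
  then show "s m \<le> x" by (simp add: s_def)
  show "s (Suc m) = (s m)\<^sup>2" by (simp add: s_def power_mult[symmetric] mult.commute)
qed

lemma iterated_square_tendsto_0: "s \<longlonglongrightarrow> 0"
proof -
  have "(\<lambda>n. x ^ n) \<longlonglongrightarrow> 0" using x by (intro LIMSEQ_power_zero) auto
  moreover have "filterlim (\<lambda>m. 2 ^ m :: nat) sequentially sequentially"
    by (rule filterlim_subseq) (auto simp: strict_mono_def)
  ultimately show ?thesis unfolding s_def by (rule filterlim_compose)
qed

lemma iterated_square_powi_tendsto: "0 < k \<Longrightarrow> (\<lambda>m. s m powi k) \<longlonglongrightarrow> 0"
  using tendsto_power[OF iterated_square_tendsto_0, of "nat k"] by (simp add: power_int_def zero_power)

lemma iterated_square_powi_le: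
  assumes "0 \<le> k" shows "s m powi k \<le> x ^ nat k"
  using iterated_square_props[of m] assms by (auto simp: power_int_def intro!: power_mono)

lemma sech_term_eq: "s m powi k / (1 + s m powi (2 * k)) = s m powi \<bar>k\<bar> / (1 + s m powi (2 * \<bar>k\<bar>))"
  using sech_symmetric[of "s m" k] iterated_square_props(1)[of m] by (cases "k \<ge> 0") auto

lemma sech_term_le: "norm (s m powi k / (1 + s m powi (2 * k))) \<le> s m powi \<bar>k\<bar>"
proof -
  have "s m powi \<bar>k\<bar> / (1 + s m powi (2 * \<bar>k\<bar>)) \<le> s m powi \<bar>k\<bar> / 1"
    using iterated_square_props(1)[of m] by (intro divide_left_mono) (auto intro!: add_pos_pos mult_pos_pos)
  moreover have "0 \<le> s m powi \<bar>k\<bar> / (1 + s m powi (2 * \<bar>k\<bar>))"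
    using iterated_square_props(1)[of m] by (intro divide_nonneg_nonneg add_nonneg_nonneg) auto
  ultimately show ?thesis unfolding sech_term_eq[of m k] by (simp only: real_norm_def abs_of_nonneg div_by_1)
qed

lemma norm_divide_iterated_square: "norm (T / s m) = norm T / s m"
  using iterated_square_props(1)[of m] by simp

lemma summable_on_int_geometric_abs: "(\<lambda>k::int. x ^ nat \<bar>k\<bar>) summable_on UNIV"
  using summable_on_int_geometric[of x 0] x by simp

text \<open>Dominated convergence; only the term \<open>k = 0\<close> survives, with value one
  half.\<close>

lemma even_sech_tendsto: "(\<lambda>m. 2 * even_sech_sum (s m)) \<longlonglongrightarrow> 1"
proof -
  have "(\<lambda>m. even_sech_sum (s m)) \<longlonglongrightarrow> infsum (\<lambda>k::int. if k = 0 then 1 / 2 else 0) UNIV"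
    unfolding even_sech_sum_def
  proof (rule tendsto_infsum_dominated[OF summable_on_int_geometric_abs])
    fix m k show "norm (if even k then s m powi k / (1 + s m powi (2 * k)) else 0) \<le> x ^ nat \<bar>k\<bar>"
      using order.trans[OF sech_term_le[of m k] iterated_square_powi_le[of "\<bar>k\<bar>" m]] x by auto
  next
    fix k :: int
    show "(\<lambda>m. if even k then s m powi k / (1 + s m powi (2 * k)) else 0) \<longlonglongrightarrow> (if k = 0 then 1 / 2 else 0)"
    proof (cases "k = 0")
      case False
      have "(\<lambda>m. s m powi k / (1 + s m powi (2 * k))) \<longlonglongrightarrow> 0"
        by (rule Lim_null_comparison[OF _ iterated_square_powi_tendsto[of "\<bar>k\<bar>"]]) (use sech_term_le False in auto)
      then show ?thesis using False by (cases "even k") auto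
    qed simp
  qed
  also have "infsum (\<lambda>k::int. if k = 0 then 1 / 2 else 0) UNIV = (1 / 2 :: real)"
    by (rule infsumI, rule has_sum_finite_neutralI[of "{0}"]) auto
  finally show ?thesis using tendsto_mult_left[of "\<lambda>m. even_sech_sum (s m)" "1/2" sequentially 2] by simp
qed

text \<open>After division by \<open>s m\<close> exactly the terms \<open>k = 1\<close> and
  \<open>k = -1\<close> survive, each with limit 1. For odd \<open>k\<close> the exponent
  \<open>\<bar>k\<bar> - 1\<close> is nonnegative, so the quotients are still dominated.\<close>

lemma odd_sech_tendsto: "(\<lambda>m. 2 * odd_sech_sum (s m) / s m) \<longlonglongrightarrow> 4"
proof -
  have "(\<lambda>m. infsum (\<lambda>k. (if odd k then s m powi k / (1 + s m powi (2 * k)) else 0) / s m) UNIV)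
     \<longlonglongrightarrow> infsum (\<lambda>k::int. if k = 1 \<or> k = -1 then 1 else 0) UNIV"
  proof (rule tendsto_infsum_dominated[OF summable_on_cmult_right[OF summable_on_int_geometric_abs, of "1 / x"]])
    fix m and k :: int
    show "norm ((if odd k then s m powi k / (1 + s m powi (2 * k)) else 0) / s m) \<le> 1 / x * x ^ nat \<bar>k\<bar>"
    proof (cases "odd k")
      case True
      then have k: "\<bar>k\<bar> - 1 \<ge> 0" by (cases "k = 0") auto
      have "norm (s m powi k / (1 + s m powi (2 * k)) / s m) \<le> s m powi \<bar>k\<bar> / s m"
        unfolding norm_divide_iterated_square by (rule divide_right_mono[OF sech_term_le less_imp_le[OF iterated_square_props(1)]])
      also have "\<dots> = s m powi (\<bar>k\<bar> - 1)" using iterated_square_props(1)[of m] by (simp add: power_int_diff)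
      also have "\<dots> \<le> x ^ nat (\<bar>k\<bar> - 1)" by (rule iterated_square_powi_le[OF k])
      also have "\<dots> = 1 / x * x ^ nat \<bar>k\<bar>"
      proof -
        have "nat \<bar>k\<bar> = Suc (nat (\<bar>k\<bar> - 1))" using k by simp
        then show ?thesis using x by simp
      qed
      finally show ?thesis using True by simp
    qed (use x in auto)
  next
    fix k :: int
    show "(\<lambda>m. (if odd k then s m powi k / (1 + s m powi (2 * k)) else 0) / s m) \<longlonglongrightarrow> (if k = 1 \<or> k = -1 then 1 else 0)"
    proof (cases "even k")
      case True
      then show ?thesis by auto
    next
      case odd: False
      show ?thesis
      proof (cases "k = 1 \<or> k = -1")
        case True
        have "(\<lambda>m. 1 / (1 + s m ^ 2)) \<longlonglongrightarrow> 1 / (1 + 0 ^ 2)"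
          by (intro tendsto_intros iterated_square_tendsto_0) auto
        moreover have "s m powi k / (1 + s m powi (2 * k)) / s m = 1 / (1 + s m ^ 2)" for m
          unfolding sech_term_eq[of m k] using True iterated_square_props(1)[of m] by auto
        ultimately show ?thesis using True by auto
      next
        case False
        then have k: "\<bar>k\<bar> - 1 > 0" using odd by (cases "k = 0") auto
        have "(\<lambda>m. s m powi k / (1 + s m powi (2 * k)) / s m) \<longlonglongrightarrow> 0"
        proof (rule Lim_null_comparison[OF _ iterated_square_powi_tendsto[OF k]], intro always_eventually allI)
          fix m
          have "norm (s m powi k / (1 + s m powi (2 * k)) / s m) \<le> s m powi \<bar>k\<bar> / s m"
            unfolding norm_divide_iterated_square by (rule divide_right_mono[OF sech_term_le less_imp_le[OF iterated_square_props(1)]])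
          also have "\<dots> = s m powi (\<bar>k\<bar> - 1)" using iterated_square_props(1)[of m] by (simp add: power_int_diff)
          finally show "norm (s m powi k / (1 + s m powi (2 * k)) / s m) \<le> s m powi (\<bar>k\<bar> - 1)" .
        qed
        then show ?thesis using odd False by auto
      qed
    qed
  qed
  also have "infsum (\<lambda>k::int. if k = 1 \<or> k = -1 then 1 else 0) UNIV = (2 :: real)"
    by (rule infsumI, rule has_sum_finite_neutralI[of "{1, -1}"]) auto
  also have "(\<lambda>m. infsum (\<lambda>k. (if odd k then s m powi k / (1 + s m powi (2 * k)) else 0) / s m) UNIV) = (\<lambda>m. odd_sech_sum (s m) / s m)"
    unfolding odd_sech_sum_def divide_inverse[of _ "s _"] by (simp only: infsum_cmult_left')
  finally show ?thesis using tendsto_mult_left[of "\<lambda>m. odd_sech_sum (s m) / s m" 2 sequentially 2] by simp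
qed

lemma theta_phi_tendsto: "(\<lambda>m. theta_phi ((s m)\<^sup>2)) \<longlonglongrightarrow> 1"
proof -
  have "(\<lambda>m. theta_phi (s (Suc m))) \<longlonglongrightarrow> infsum (\<lambda>k::int. if k = 0 then 1 else 0) UNIV"
    unfolding theta_phi_def
  proof (rule tendsto_infsum_dominated[OF summable_on_int_geometric_abs])
    fix m and k :: int
    have "s (Suc m) powi (k\<^sup>2) \<le> x ^ nat (k\<^sup>2)" by (rule iterated_square_powi_le) auto
    also have "\<dots> \<le> x ^ nat \<bar>k\<bar>" using abs_le_square_int[of k] x by (intro power_decreasing nat_mono) auto
    finally show "norm (s (Suc m) powi (k\<^sup>2)) \<le> x ^ nat \<bar>k\<bar>" using iterated_square_props(1)[of "Suc m"] by simp
  next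
    fix k :: int
    show "(\<lambda>m. s (Suc m) powi (k\<^sup>2)) \<longlonglongrightarrow> (if k = 0 then 1 else 0)"
      using LIMSEQ_Suc[OF iterated_square_powi_tendsto[of "k\<^sup>2"]] by (cases "k = 0") auto
  qed
  also have "infsum (\<lambda>k::int. if k = 0 then 1 else 0) UNIV = (1 :: real)"
    by (rule infsumI, rule has_sum_finite_neutralI[of "{0}"]) auto
  finally show ?thesis by (simp only: iterated_square_props)
qed

text \<open>The exponent vanishes at \<open>-1\<close> as well as at 0, hence the limit 2; its
  square matches the limit 4 of the odd secant sums.\<close>

lemma theta_psi_tendsto: "(\<lambda>m. theta_psi ((s m)\<^sup>2)) \<longlonglongrightarrow> 2"
proof -
  have "(\<lambda>m. theta_psi (s (Suc m))) \<longlonglongrightarrow> infsum (\<lambda>k::int. if k = 0 \<or> k = -1 then 1 else 0) UNIV"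
    unfolding theta_psi_def
  proof (rule tendsto_infsum_dominated[OF summable_geometric_bound[OF x]])
    fix m and k :: int
    have n: "0 \<le> k * (k + 1)" by (rule pronic_int_nonneg)
    have "s (Suc m) powi (k * (k + 1)) \<le> x ^ nat (k * (k + 1))" by (rule iterated_square_powi_le[OF n])
    also have "\<dots> = x powi (k * (k + 1))" using n by (simp add: power_int_def)
    also have "\<dots> \<le> 1 / x * x ^ nat \<bar>k\<bar>" by (rule powi_le_geometric[OF x abs_le_pronic_int n])
    finally show "norm (s (Suc m) powi (k * (k + 1))) \<le> 1 / x * x ^ nat \<bar>k\<bar>" using iterated_square_props(1)[of "Suc m"] by simp
  next
    fix k :: int
    show "(\<lambda>m. s (Suc m) powi (k * (k + 1))) \<longlonglongrightarrow> (if k = 0 \<or> k = -1 then 1 else 0)"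
    proof (cases "k = 0 \<or> k = -1")
      case False
      then have "k * (k + 1) \<noteq> 0" by auto
      then have "0 < k * (k + 1)" using pronic_int_nonneg[of k] by linarith
      from LIMSEQ_Suc[OF iterated_square_powi_tendsto[OF this]] show ?thesis using False by auto
    qed auto
  qed
  also have "infsum (\<lambda>k::int. if k = 0 \<or> k = -1 then 1 else 0) UNIV = (2 :: real)"
    by (rule infsumI, rule has_sum_finite_neutralI[of "{0, -1}"]) auto
  finally show ?thesis by (simp only: iterated_square_props)
qed

end

lemma infsum_pos:
  fixes f :: "'a \<Rightarrow> real"
  assumes "f summable_on A" "\<And>k. k \<in> A \<Longrightarrow> 0 \<le> f k" "a \<in> A" "0 < f a"
  shows "0 < infsum f A"
  using finite_sum_le_infsum[of f A "{a}"] assms by simp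

lemma theta_phi_pos: "0 < x \<Longrightarrow> x < 1 \<Longrightarrow> 0 < theta_phi x"
  unfolding theta_phi_def by (rule infsum_pos[OF summable_phi, where a = 0]) auto

lemma theta_psi_pos: "0 < x \<Longrightarrow> x < 1 \<Longrightarrow> 0 < theta_psi x"
  unfolding theta_psi_def by (rule infsum_pos[OF summable_psi, where a = 0]) auto

lemma sech_sum_pos:
  assumes s: "0 < s" "s < 1"
  shows "0 < even_sech_sum s" "0 < odd_sech_sum s"
proof -
  have q: "complex_of_real s \<noteq> 0" "norm (complex_of_real s) < 1" using s by auto
  have 1: "(\<lambda>k::int. s powi k / (1 + s powi (2 * k))) summable_on UNIV"
  proof -
    have "lambert_weight_plus (complex_of_real s) summable_on UNIV"
      using rapidD[OF rapid_lambert_weight_plus[OF q], of 0] by simp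
    from summable_on_Re[OF this] show ?thesis
      unfolding lambert_weight_plus_of_real Re_complex_of_real .
  qed
  have 2: "(\<lambda>k::int. if P k then s powi k / (1 + s powi (2 * k)) else 0) summable_on UNIV" for P
  proof -
    have "(\<lambda>k::int. s powi k / (1 + s powi (2 * k))) summable_on {k. P k}"
      by (rule summable_on_subset_banach[OF 1]) auto
    also have "?this \<longleftrightarrow> ?thesis"
      by (rule summable_on_cong_neutral) auto
    finally show ?thesis .
  qed
  have p: "0 < s powi k / (1 + s powi (2 * k))" for k :: int
    using s by (intro divide_pos_pos add_pos_pos) auto
  show "0 < even_sech_sum s" unfolding even_sech_sum_def
    by (rule infsum_pos[OF 2, where a = 0]) (use p[THEN less_imp_le] in auto)
  show "0 < odd_sech_sum s" unfolding odd_sech_sum_def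
    by (rule infsum_pos[OF 2, where a = 1]) (use p[THEN less_imp_le] p[of 1] in auto)
qed

text \<open>The secant pair and the theta pair satisfy the same recurrences with the same limits.
  \<open>agm_ratio_bound\<close> is applied twice with the roles exchanged, one inequality
  each.\<close>

lemma odd_sech_sum_eq_theta_psi:
  assumes x: "0 < x" "x < 1"
  shows "2 * odd_sech_sum x / x = theta_psi (x\<^sup>2) ^ 2"
proof -
  define s :: "nat \<Rightarrow> real" where "s = (\<lambda>m. x ^ (2 ^ m))"
  have sp: "0 < s m" "s m < 1" "s m \<le> x" "s (Suc m) = (s m)\<^sup>2" for m
    unfolding s_def by (rule iterated_square_props[OF x])+
  \<comment> \<open>The factor 2 and the division by \<open>s m\<close> normalize the secant sums to
    the limits 1 and 4 of the squared theta series.\<close>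
  define a where "a m = 2 * even_sech_sum (s m)" for m
  define b where "b m = 2 * odd_sech_sum (s m) / s m" for m
  define a' where "a' m = theta_phi ((s m)\<^sup>2) ^ 2" for m
  define b' where "b' m = theta_psi ((s m)\<^sup>2) ^ 2" for m
  have pos: "0 < a m" "0 < b m" "0 < a' m" "0 < b' m" "0 \<le> s (Suc m)" for m
    using sech_sum_pos[OF sp(1,2)[of m]] theta_phi_pos[OF sp(1,2)[of "Suc m"]]
      theta_psi_pos[OF sp(1,2)[of "Suc m"]] sp(1)[of m] sp(1)[of "Suc m"]
    by (auto simp: a_def b_def a'_def b'_def sp(4))
  have A: "a m = a (Suc m) + s (Suc m) * b (Suc m)" for m
    using sech_sum_relations(1)[OF sp(1,2)[of m]] sp(1)[of "Suc m"]
    by (simp add: a_def b_def sp(4))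
  have A': "a' m = a' (Suc m) + s (Suc m) * b' (Suc m)" for m
    using theta_phi_square[OF sp(1,2)[of "Suc m"]] by (simp add: a'_def b'_def sp(4))
  have B: "(b m)\<^sup>2 = 4 * a (Suc m) * b (Suc m)" for m
    using sech_sum_relations(2)[OF sp(1,2)[of m]] sp(1)[of m]
    by (simp add: a_def b_def sp(4) power_divide power_mult_distrib)
  have B': "(b' m)\<^sup>2 = 4 * a' (Suc m) * b' (Suc m)" for m
    using theta_psi_square[OF sp(1,2)[of "Suc m"]] by (simp add: a'_def b'_def sp(4) power_mult_distrib)
  have lim: "a \<longlonglongrightarrow> 1" "b \<longlonglongrightarrow> 4"
    using even_sech_tendsto[OF x] odd_sech_tendsto[OF x] by (simp_all add: a_def[abs_def] b_def[abs_def] s_def)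
  have lim': "a' \<longlonglongrightarrow> 1" "b' \<longlonglongrightarrow> 4"
    using tendsto_power[OF theta_phi_tendsto[OF x], of 2] tendsto_power[OF theta_psi_tendsto[OF x], of 2]
    by (simp_all add: a'_def[abs_def] b'_def[abs_def] s_def)
  have "b 0 \<le> b' 0"
    by (rule agm_ratio_bound[where x = "\<lambda>m. s (Suc m)", OF pos A A' B B' lim(1) lim'(1) lim(2) lim'(2)])
  moreover have "b' 0 \<le> b 0"
    by (rule agm_ratio_bound[where x = "\<lambda>m. s (Suc m)", OF pos(3,4,1,2,5) A' A B' B lim'(1) lim(1) lim'(2) lim(2)])
  ultimately have "b 0 = b' 0" by simp
  then show ?thesis by (simp add: b_def b'_def s_def)
qed

text \<open>Square the preceding identity at \<open>x = sqrt y\<close> and express the squared odd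
  sum by \<open>sech_sum_relations(3)\<close>.\<close>

lemma lambert_C_1_real:
  assumes y: "0 < y" "y < 1"
  shows "complex_of_real (y * theta_psi y ^ 4) = 16 * lambert_C 1 (of_real y)"
proof -
  define x where "x = sqrt y"
  have x: "0 < x" "x < 1" "x\<^sup>2 = y" using y by (auto simp: x_def)
  have e: "2 * odd_sech_sum x = x * theta_psi y ^ 2"
    using odd_sech_sum_eq_theta_psi[OF x(1,2)] x by (simp add: field_simps)
  have "4 * odd_sech_sum x ^ 2 = (2 * odd_sech_sum x) ^ 2"
    by (simp add: power_mult_distrib)
  also have "\<dots> = x\<^sup>2 * (theta_psi y ^ 2) ^ 2"
    unfolding e power_mult_distrib ..
  also have "\<dots> = y * theta_psi y ^ 4" by (simp add: x(3) power_mult[symmetric])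
  finally have r: "4 * odd_sech_sum x ^ 2 = y * theta_psi y ^ 4" .
  have "complex_of_real (y * theta_psi y ^ 4) = 4 * of_real (odd_sech_sum x ^ 2)"
    unfolding r[symmetric] of_real_mult by simp
  then show ?thesis unfolding sech_sum_relations(3)[OF x(1,2)] x(3) by simp
qed

section \<open>Analytic continuation from the real interval to the disc\<close>

text \<open>The majorant on each smaller closed disc gives uniform convergence there, and a uniform
  limit of holomorphic functions is holomorphic.\<close>

lemma holomorphic_on_infsum_ball:
  fixes f :: "'k \<Rightarrow> complex \<Rightarrow> complex"
  assumes hol: "\<And>k. k \<in> A \<Longrightarrow> f k holomorphic_on ball 0 1"
    and bound: "\<And>r. 0 < r \<Longrightarrow> r < 1 \<Longrightarrow> \<exists>M. M summable_on A \<and> (\<forall>k\<in>A. \<forall>z\<in>cball 0 r. norm (f k z) \<le> M k)"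
  shows "(\<lambda>z. \<Sum>\<^sub>\<infinity>k\<in>A. f k z) holomorphic_on ball 0 1"
  unfolding holomorphic_on_def
proof
  fix z :: complex assume z: "z \<in> ball 0 1"
  define r where "r = (1 + norm z) / 2"
  have r: "0 < r" "r < 1" "norm z < r"
    using z norm_ge_zero[of z] by (auto simp: r_def simp del: norm_ge_zero)
  obtain M where M: "M summable_on A" "\<forall>k\<in>A. \<forall>z\<in>cball 0 r. norm (f k z) \<le> M k"
    using bound[OF r(1,2)] by blast
  have u: "uniform_limit (cball 0 r) (\<lambda>X z. \<Sum>k\<in>X. f k z) (\<lambda>z. \<Sum>\<^sub>\<infinity>k\<in>A. f k z) (finite_subsets_at_top A)"
    by (rule Weierstrass_m_test_general[OF _ M(1)]) (use M(2) in blast)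
  have sub: "cball (0::complex) r \<subseteq> ball 0 1" using r by auto
  have hr: "f k holomorphic_on cball 0 r" if "k \<in> A" for k
    by (rule holomorphic_on_subset[OF hol[OF that] sub])
  have "\<forall>\<^sub>F X in finite_subsets_at_top A. continuous_on (cball 0 r) (\<lambda>z. \<Sum>k\<in>X. f k z) \<and>
      (\<lambda>z. \<Sum>k\<in>X. f k z) holomorphic_on ball 0 r"
  proof (rule eventually_finite_subsets_at_top_weakI)
    fix X assume X: "finite X" "X \<subseteq> A"
    have "(\<lambda>z. \<Sum>k\<in>X. f k z) holomorphic_on cball 0 r"
      by (intro holomorphic_on_sum hr) (use X in auto)
    then show "continuous_on (cball 0 r) (\<lambda>z. \<Sum>k\<in>X. f k z) \<and> (\<lambda>z. \<Sum>k\<in>X. f k z) holomorphic_on ball 0 r"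
      using holomorphic_on_imp_continuous_on holomorphic_on_subset ball_subset_cball by blast
  qed
  from holomorphic_uniform_limit[OF this u] have "(\<lambda>z. \<Sum>\<^sub>\<infinity>k\<in>A. f k z) holomorphic_on ball 0 r"
    by auto
  then have "(\<lambda>z. \<Sum>\<^sub>\<infinity>k\<in>A. f k z) field_differentiable at z"
    by (rule holomorphic_on_imp_differentiable_at) (use r in auto)
  then show "(\<lambda>z. \<Sum>\<^sub>\<infinity>k\<in>A. f k z) field_differentiable at z within ball 0 1"
    by (rule field_differentiable_at_within)
qed

lemma holomorphic_psi: "(\<lambda>q. \<Sum>\<^sub>\<infinity>j::int. q powi (j * (j + 1))) holomorphic_on ball 0 1"
proof -
  have eq: "q powi (j * (j + 1)) = q ^ nat (j * (j + 1))" for q :: complex and j :: int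
    using pronic_int_nonneg[of j] by (simp add: power_int_def)
  have "(\<lambda>q. \<Sum>\<^sub>\<infinity>j::int. q ^ nat (j * (j + 1))) holomorphic_on ball (0::complex) 1"
  proof (rule holomorphic_on_infsum_ball)
    fix r :: real assume r: "0 < r" "r < 1"
    show "\<exists>M. M summable_on (UNIV :: int set) \<and> (\<forall>j\<in>UNIV. \<forall>z\<in>cball (0::complex) r. norm (z ^ nat (j * (j + 1))) \<le> M j)"
    proof (intro exI conjI ballI)
      show "(\<lambda>j::int. 1 / r * r ^ nat \<bar>j\<bar>) summable_on UNIV" by (rule summable_geometric_bound[OF r])
      fix j :: int and z :: complex assume "z \<in> cball 0 r"
      then have "norm (z ^ nat (j * (j + 1))) \<le> r ^ nat (j * (j + 1))" by (simp add: norm_power power_mono)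
      also have "\<dots> = r powi (j * (j + 1))" using pronic_int_nonneg[of j] by (simp add: power_int_def)
      also have "\<dots> \<le> 1 / r * r ^ nat \<bar>j\<bar>"
        by (rule powi_le_geometric[OF r abs_le_pronic_int pronic_int_nonneg])
      finally show "norm (z ^ nat (j * (j + 1))) \<le> 1 / r * r ^ nat \<bar>j\<bar>" .
    qed
  qed (auto intro!: holomorphic_intros)
  then show ?thesis by (simp only: eq)
qed

lemma holomorphic_lambert_C_1: "lambert_C 1 holomorphic_on ball 0 1"
proof -
  have ne: "1 - z ^ (2 * (2 * k + 1)) \<noteq> 0" if "norm z < 1" for z :: complex and k :: nat
  proof
    assume "1 - z ^ (2 * (2 * k + 1)) = 0"
    then have "norm z ^ (2 * (2 * k + 1)) = 1" by (metis eq_iff_diff_eq_0 norm_one norm_power)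
    moreover have "norm z ^ (2 * (2 * k + 1)) < 1"
      by (subst power_less_one_iff) (use that in auto)
    ultimately show False by linarith
  qed
  have "(\<lambda>z. \<Sum>\<^sub>\<infinity>a::nat. of_nat (2 * a + 1) * (z ^ (2 * a + 1) / (1 - z ^ (2 * (2 * a + 1))))) holomorphic_on ball (0::complex) 1"
  proof (rule holomorphic_on_infsum_ball)
    fix k :: nat
    show "(\<lambda>z. of_nat (2 * k + 1) * (z ^ (2 * k + 1) / (1 - z ^ (2 * (2 * k + 1))))) holomorphic_on ball (0::complex) 1"
      by (intro holomorphic_intros) (use ne in auto)
  next
    fix r :: real assume r: "0 < r" "r < 1"
    have "(\<lambda>k. real k ^ 1 * r ^ k) summable_on range (\<lambda>a. 2 * a + 1)"
      by (rule summable_on_subset_banach[OF summable_on_nat_geometric]) (use r in auto)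
    then have "(\<lambda>a. real (2 * a + 1) * r ^ (2 * a + 1)) summable_on UNIV"
      by (subst (asm) summable_on_reindex) (auto simp: o_def inj_on_def)
    then have s: "(\<lambda>a. 1 / (1 - r) * (real (2 * a + 1) * r ^ (2 * a + 1))) summable_on UNIV"
      by (rule summable_on_cmult_right)
    show "\<exists>M. M summable_on (UNIV :: nat set) \<and> (\<forall>a\<in>UNIV. \<forall>z\<in>cball (0::complex) r.
        norm (of_nat (2 * a + 1) * (z ^ (2 * a + 1) / (1 - z ^ (2 * (2 * a + 1))))) \<le> M a)"
    proof (intro exI conjI ballI, rule s)
      fix a :: nat and z :: complex assume z: "z \<in> cball 0 r"
      have "norm (z ^ (2 * (2 * a + 1))) \<le> r ^ (2 * (2 * a + 1))"
        unfolding norm_power by (rule power_mono) (use z in auto)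
      also have "\<dots> \<le> r ^ 1" by (rule power_decreasing) (use r in auto)
      finally have d: "1 - r \<le> norm (1 - z ^ (2 * (2 * a + 1)))"
        using norm_triangle_ineq2[of 1 "z ^ (2 * (2 * a + 1))"] by simp
      have "norm (z ^ (2 * a + 1)) \<le> r ^ (2 * a + 1)"
        unfolding norm_power by (rule power_mono) (use z in auto)
      then have "norm (z ^ (2 * a + 1)) / norm (1 - z ^ (2 * (2 * a + 1))) \<le> r ^ (2 * a + 1) / (1 - r)"
        using d r by (intro frac_le) auto
      then have "real (2 * a + 1) * (norm (z ^ (2 * a + 1)) / norm (1 - z ^ (2 * (2 * a + 1)))) \<le> real (2 * a + 1) * (r ^ (2 * a + 1) / (1 - r))"
        by (rule mult_left_mono) auto
      then show "norm (of_nat (2 * a + 1) * (z ^ (2 * a + 1) / (1 - z ^ (2 * (2 * a + 1))))) \<le> 1 / (1 - r) * (real (2 * a + 1) * r ^ (2 * a + 1))"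
        unfolding norm_mult norm_divide norm_of_nat by simp
    qed
  qed
  then show ?thesis by (simp only: lambert_C_1_altdef[abs_def])
qed

text \<open>Identity theorem: both sides are holomorphic on the disc and agree on the interval from
  0 to 1, which accumulates at the interior point 0.\<close>

lemma lambert_C_1_eq_psi:
  assumes "norm q < 1"
  shows "q * (\<Sum>\<^sub>\<infinity>j::int. q powi (j * (j + 1))) ^ 4 = 16 * lambert_C 1 q"
proof -
  define H where "H q = q * (\<Sum>\<^sub>\<infinity>j::int. q powi (j * (j + 1))) ^ 4 - 16 * lambert_C 1 q" for q :: complex
  have "H q = 0"
  proof (rule analytic_continuation[of H "ball 0 1" "of_real ` {0<..<1}" 0])
    show "H holomorphic_on ball 0 1"
      unfolding H_def[abs_def] by (intro holomorphic_intros holomorphic_psi holomorphic_lambert_C_1)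
    show "of_real ` {0<..<1} \<subseteq> ball (0::complex) 1" by auto
    show "(0::complex) islimpt of_real ` {0<..<1}"
      unfolding islimpt_approachable
    proof (intro allI impI)
      fix e :: real assume e: "e > 0"
      have "of_real (min (e / 2) (1 / 2)) \<in> (of_real ` {0<..<1} :: complex set)"
        by (rule imageI) (use e in auto)
      moreover have "of_real (min (e / 2) (1 / 2)) \<noteq> (0 :: complex)"
        unfolding of_real_eq_0_iff using e by auto
      moreover have "dist (of_real (min (e / 2) (1 / 2))) (0 :: complex) < e"
        using e by (auto simp: min_def)
      ultimately show "\<exists>x'\<in>of_real ` {0<..<1}. x' \<noteq> (0::complex) \<and> dist x' 0 < e" by blast
    qed
    fix z :: complex assume "z \<in> of_real ` {0<..<1}"
    then obtain y where y: "z = of_real y" "0 < y" "y < 1" by auto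
    have "((\<lambda>j::int. complex_of_real (y powi (j * (j + 1)))) has_sum of_real (theta_psi y)) UNIV"
      by (rule has_sum_of_real) (use summable_psi[OF y(2,3)] in \<open>simp add: theta_psi_def\<close>)
    then have "(\<Sum>\<^sub>\<infinity>j::int. z powi (j * (j + 1))) = of_real (theta_psi y)"
      by (intro infsumI) (simp add: y)
    then show "H z = 0" using lambert_C_1_real[OF y(2,3)] by (simp add: H_def y)
  qed (use assms in auto)
  then show ?thesis by (simp add: H_def)
qed

lemma theta2_power4:
  assumes "q \<noteq> 0" "norm q < 1"
  shows "theta2 q ^ (4 * m) = (16 * lambert_C 1 q) ^ m"
  unfolding theta2_power_4[OF assms(1)] lambert_C_1_eq_psi[OF assms(2), symmetric]
  by (simp only: power_mult_distrib power_mult)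

section \<open>Hankel determinants\<close>

text \<open>Row \<open>r\<close> holds the coordinates of the \<open>r\<close>-th iterate of the tridiagonal operator on the first
  basis vector.\<close>
fun hankel_factor :: "(nat \<Rightarrow> 'a::comm_ring_1) \<Rightarrow> (nat \<Rightarrow> 'a) \<Rightarrow> (nat \<Rightarrow> 'a) \<Rightarrow> nat \<Rightarrow> nat \<Rightarrow> 'a" where
  "hankel_factor d b u 0 k = (if k = 0 then 1 else 0)"
| "hankel_factor d b u (Suc r) k =
     d (Suc k) * hankel_factor d b u r (Suc k) + b k * hankel_factor d b u r k + (if k = 0 then 0 else u (k - 1) * hankel_factor d b u r (k - 1))"

lemma hankel_factor_eq_0: "r < k \<Longrightarrow> hankel_factor d b u r k = 0"
  by (induction r arbitrary: k) auto

lemma hankel_factor_diag: "hankel_factor d b u r r = (\<Prod>j<r. u j)"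
  by (induction r) (auto simp: hankel_factor_eq_0 mult.commute)

text \<open>Here \<open>y r k\<close> is a linear functional applied to the \<open>r\<close>-th
  iterate of a tridiagonal operator on the \<open>k\<close>-th basis vector. Moving \<open>i\<close>
  of the \<open>i + j\<close> steps onto the coordinates factors the Hankel matrix into a lower and
  an upper triangular one, whose diagonals are products of the entries \<open>u\<close> and of
  \<open>c\<close> with the entries \<open>d\<close>.\<close>

lemma det_hankel_tridiagonal:
  fixes y :: "nat \<Rightarrow> nat \<Rightarrow> 'a::idom"
  assumes y0: "\<And>k. y 0 k = (if k = 0 then c else 0)"
    and yS: "\<And>r k. y (Suc r) k =
      (if k = 0 then 0 else d k * y r (k - 1)) + b k * y r k + u k * y r (Suc k)"
  shows "det (mat n n (\<lambda>(i, j). y (i + j) 0)) = c ^ n * (\<Prod>i<n. \<Prod>j=1..i. d j * u (j - 1))"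
proof -
  have y_eq_0: "y r k = 0" if "r < k" for r k
    using that by (induction r arbitrary: k) (auto simp: y0 yS)
  have y_diag: "y r r = c * (\<Prod>j=1..r. d j)" for r
    by (induction r) (auto simp: y0 yS y_eq_0)
  \<comment> \<open>The sum may stop at \<open>i\<close> because \<open>i\<close> steps of a
    tridiagonal operator reach at most the \<open>i\<close>-th basis vector.\<close>
  have fac: "y (i + j) 0 = (\<Sum>k\<le>i. hankel_factor d b u i k * y j k)" for i j
  proof (induction i arbitrary: j)
    case (Suc i)
    \<comment> \<open>The next three equations shift indices so that the operator acts on the
      coordinates instead of on \<open>y\<close>. Added boundary terms vanish by
      \<open>hankel_factor_eq_0\<close> or by the zero entry at \<open>k = 0\<close>.\<close>
    have 1: "(\<Sum>k\<le>i. hankel_factor d b u i k * (if k = 0 then 0 else d k * y j (k - 1))) =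
             (\<Sum>k\<le>Suc i. d (Suc k) * hankel_factor d b u i (Suc k) * y j k)"
    proof -
      have "(\<Sum>k\<le>i. hankel_factor d b u i k * (if k = 0 then 0 else d k * y j (k - 1))) =
        (\<Sum>k\<le>Suc (Suc i). hankel_factor d b u i k * (if k = 0 then 0 else d k * y j (k - 1)))"
        by (simp add: hankel_factor_eq_0)
      also have "\<dots> = (\<Sum>k\<le>Suc i. hankel_factor d b u i (Suc k) * (d (Suc k) * y j k))"
        by (subst sum.atMost_Suc_shift) simp
      finally show ?thesis by (simp add: mult_ac)
    qed
    have 2: "(\<Sum>k\<le>i. hankel_factor d b u i k * (u k * y j (Suc k))) =
             (\<Sum>k\<le>Suc i. (if k = 0 then 0 else u (k - 1) * hankel_factor d b u i (k - 1)) * y j k)"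
      by (subst sum.atMost_Suc_shift) (simp add: mult_ac)
    have 3: "(\<Sum>k\<le>i. hankel_factor d b u i k * (b k * y j k)) = (\<Sum>k\<le>Suc i. b k * hankel_factor d b u i k * y j k)"
      by (simp add: hankel_factor_eq_0 mult_ac)
    have "y (Suc i + j) 0 = (\<Sum>k\<le>i. hankel_factor d b u i k * y (Suc j) k)"
      using Suc.IH[of "Suc j"] by simp
    also have "\<dots> = (\<Sum>k\<le>Suc i. hankel_factor d b u (Suc i) k * y j k)"
      unfolding yS distrib_left sum.distrib 1 2 3
      by (simp only: hankel_factor.simps sum.distrib[symmetric] distrib_right)
    finally show ?case .
  qed (simp add: y0)
  define P where "P = mat n n (\<lambda>(i, k). hankel_factor d b u i k)"
  define Y where "Y = mat n n (\<lambda>(k, j). y j k)"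
  have PY: "P \<in> carrier_mat n n" "Y \<in> carrier_mat n n" by (auto simp: P_def Y_def)
  have "mat n n (\<lambda>(i, j). y (i + j) 0) = P * Y"
  proof (rule eq_matI)
    fix i j assume "i < dim_row (P * Y)" "j < dim_col (P * Y)"
    then have ij: "i < n" "j < n" using PY by auto
    have "(P * Y) $$ (i, j) = (\<Sum>k<n. hankel_factor d b u i k * y j k)"
      using ij by (simp add: P_def Y_def scalar_prod_def atLeast0LessThan)
    also have "\<dots> = (\<Sum>k\<le>i. hankel_factor d b u i k * y j k)"
      by (rule sum.mono_neutral_right) (use ij in \<open>auto simp: hankel_factor_eq_0\<close>)
    finally show "mat n n (\<lambda>(i, j). y (i + j) 0) $$ (i, j) = (P * Y) $$ (i, j)"
      using ij by (simp add: fac)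
  qed (use PY in auto)
  moreover have "det P = (\<Prod>i<n. \<Prod>j<i. u j)"
    by (subst det_lower_triangular[OF _ PY(1)])
       (auto simp: P_def hankel_factor_eq_0 hankel_factor_diag prod_list_diag_prod atLeast0LessThan intro!: prod.cong)
  moreover have "det Y = (\<Prod>i<n. c * (\<Prod>j=1..i. d j))"
    by (subst det_upper_triangular[OF _ PY(2)])
       (auto simp: Y_def y_eq_0 y_diag prod_list_diag_prod atLeast0LessThan intro!: prod.cong)
  moreover have "(\<Prod>j<i. u j) = (\<Prod>j=1..i. u (j - 1))" for i
    by (rule prod.reindex_bij_witness[of _ "\<lambda>j. j - 1" Suc]) auto
  ultimately show ?thesis
    using PY by (simp add: det_mult prod.distrib mult_ac)
qed

section \<open>The second derivative on powers of \<open>F\<close>\<close>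

context
  fixes F :: "'a::field_char_0 fps" and \<alpha> c :: 'a
  assumes ode: "fps_deriv (fps_deriv F) = 8 * F ^ 3 + fps_const \<alpha> * F"
    and F0: "fps_nth F 0 = 0" and F1: "fps_nth F 1 = c"
begin

text \<open>The first integral: multiplying the equation by \<open>2 F'\<close> makes it a total
  derivative, and the constant is read off at 0, where \<open>F\<close> is 0 and \<open>F'\<close>
  is \<open>c\<close>.\<close>

lemma ode_first: "(fps_deriv F)\<^sup>2 = fps_const (c\<^sup>2) + fps_const \<alpha> * F\<^sup>2 + 4 * F ^ 4"
proof -
  define E where "E = (fps_deriv F)\<^sup>2 - fps_const \<alpha> * F\<^sup>2 - 4 * F ^ 4"
  have "fps_deriv E = 2 * fps_deriv F * (fps_deriv (fps_deriv F) - fps_const \<alpha> * F - 8 * F ^ 3)"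
    by (simp add: E_def fps_deriv_power algebra_simps power2_eq_square power3_eq_cube numeral_eq_Suc)
  also have "\<dots> = 0" by (simp add: ode)
  finally have "E = fps_const (fps_nth E 0)" by (simp add: fps_deriv_eq_0_iff)
  also have "fps_nth E 0 = c\<^sup>2"
    using F0 F1 by (simp add: E_def power2_eq_square fps_mult_nth_0 numeral_eq_Suc)
  finally show ?thesis by (simp add: E_def algebra_simps)
qed

text \<open>In \<open>(F^j)'' = j (j - 1) F^(j-2) F'^2 + j F^(j-1) F''\<close> replace
  \<open>F'^2\<close> by \<open>ode_first\<close> and \<open>F''\<close> by the equation. Exponents
  move by 2 only, so odd and even powers stay apart.\<close>

lemma ode_power:
  "fps_deriv (fps_deriv (F ^ j)) =
     fps_const (of_nat j * of_nat (j - 1) * c\<^sup>2) * F ^ (j - 2) +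
     fps_const (of_nat j ^ 2 * \<alpha>) * F ^ j + fps_const (4 * of_nat j * of_nat (j + 1)) * F ^ (j + 2)"
\<comment> \<open>The truncated differences are harmless here since the coefficient
  \<open>j * (j - 1)\<close> is 0.\<close>
proof (cases "j < 2")
  case True
  then have "j = 0 \<or> j = 1" by auto
  then show ?thesis
    by (auto simp: ode fps_const_mult[symmetric] power3_eq_cube power2_eq_square numeral_fps_const simp del: fps_const_mult)
next
  case False
  define m where "m = j - 2"
  have j: "j = Suc (Suc m)" using False by (simp add: m_def)
  have d: "fps_deriv (F ^ Suc k) = of_nat (Suc k) * F ^ k * fps_deriv F" for k
    by (simp only: fps_deriv_power' diff_Suc_1 mult_ac)
  have "fps_deriv (fps_deriv (F ^ j)) =
    of_nat j * of_nat (Suc m) * F ^ m * (fps_deriv F)\<^sup>2 + of_nat j * F ^ (Suc m) * fps_deriv (fps_deriv F)"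
    unfolding j d fps_deriv_mult fps_deriv_of_nat by (simp add: power2_eq_square algebra_simps del: of_nat_Suc)
  also have "\<dots> = of_nat j * of_nat (Suc m) * F ^ m * (fps_const (c\<^sup>2) + fps_const \<alpha> * F\<^sup>2 + 4 * F ^ 4)
     + of_nat j * F ^ (Suc m) * (8 * F ^ 3 + fps_const \<alpha> * F)"
    by (simp only: ode_first ode)
  also have "\<dots> = of_nat j * of_nat (j-1) * fps_const (c\<^sup>2) * F ^ (j - 2) + of_nat j ^ 2 * fps_const \<alpha> * F ^ j
     + 4 * of_nat j * of_nat (j + 1) * F ^ (j + 2)"
    by (simp add: j algebra_simps numeral_eq_Suc)
  finally show ?thesis
    by (simp only: fps_const_mult[symmetric] fps_const_power[symmetric] fps_of_nat numeral_fps_const)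
qed

end

lemma power_nth_less:
  fixes F :: "'a::comm_ring_1 fps"
  assumes "fps_nth F 0 = 0" "n < k" shows "fps_nth (F ^ k) n = 0"
  using startsby_zero_power_prefix[OF assms(1), of k] assms(2) by blast

lemma fact_nth_deriv2: "fact (n + 2) * fps_nth f (n + 2) = fact n * fps_nth (fps_deriv (fps_deriv f)) n"
  for f :: "'a::field_char_0 fps"
  by (simp add: algebra_simps)

section \<open>Evaluation of the off-diagonal products\<close>

text \<open>The factors are the quotients of consecutive right-hand sides.\<close>

lemma prod_fact_odd:
  "(\<Prod>j=1..k. (of_nat (2 * j + 1) * of_nat (2 * j)) * (of_nat (2 * j - 1) * of_nat (2 * j))) =
     (fact (2 * k) * fact (2 * k + 1) :: 'a::field_char_0)"
proof (induction k)
  case (Suc k)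
  have f1: "(fact (2 * Suc k) :: 'a) = of_nat (2 * Suc k) * (of_nat (2 * Suc k - 1) * fact (2 * k))"
    and f2: "(fact (2 * Suc k + 1) :: 'a) = of_nat (2 * Suc k + 1) * (of_nat (2 * Suc k) * fact (2 * k + 1))"
    by simp_all
  have "1 \<le> Suc k" by simp
  show ?case unfolding f1 f2 prod.nat_ivl_Suc'[OF \<open>1 \<le> Suc k\<close>] Suc.IH by (simp only: mult_ac)
qed simp

text \<open>Again quotients of consecutive values; the leading 2 is the starting value
  \<open>fact 1 * fact 2\<close>.\<close>

lemma prod_fact_even:
  "2 * (\<Prod>j=1..k. (of_nat (2 * j + 2) * of_nat (2 * j + 1)) * (of_nat (2 * j) * of_nat (2 * j + 1))) =
     (fact (2 * k + 1) * fact (2 * k + 2) :: 'a::field_char_0)"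
proof (induction k)
  case (Suc k)
  have f1: "(fact (2 * Suc k + 1) :: 'a) = of_nat (2 * Suc k + 1) * (of_nat (2 * Suc k) * fact (2 * k + 1))"
    and f2: "(fact (2 * Suc k + 2) :: 'a) = of_nat (2 * Suc k + 2) * (of_nat (2 * Suc k + 1) * fact (2 * k + 2))"
    by (simp_all add: algebra_simps)
  have "1 \<le> Suc k" by simp
  show ?case
    unfolding f1 f2 prod.nat_ivl_Suc'[OF \<open>1 \<le> Suc k\<close>] mult.left_commute[of 2] Suc.IH by (simp only: mult_ac)
qed simp

text \<open>Each off-diagonal product carries \<open>(4 * c)\<^sup>2\<close>, and
  \<open>4 ^ n\<close> completes \<open>c ^ n\<close>. The exponents add up as
  \<open>n + n (n - 1) = n^2\<close>, and the inner factorials run through two consecutive values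
  each.\<close>

lemma prod_hankel_odd:
  "4 ^ n * (c ^ n * (\<Prod>i<n. \<Prod>j=1..i. (of_nat (2 * j + 1) * of_nat (2 * j) * (2 * c)\<^sup>2) *
       (4 * of_nat (2 * (j - 1) + 1) * of_nat (2 * (j - 1) + 2)))) =
     (4 * c) ^ n\<^sup>2 * (\<Prod>r=1..2 * n - 1. fact r :: 'a::field_char_0)"
proof -
  have inner: "(\<Prod>j=1..i. (of_nat (2 * j + 1) * of_nat (2 * j) * (2 * c)\<^sup>2) *
       (4 * of_nat (2 * (j - 1) + 1) * of_nat (2 * (j - 1) + 2))) = (4 * c) ^ (2 * i) * (fact (2 * i) * fact (2 * i + 1))" for i
  proof -
    have "(\<Prod>j=1..i. (of_nat (2 * j + 1) * of_nat (2 * j) * (2 * c)\<^sup>2) *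
       (4 * of_nat (2 * (j - 1) + 1) * of_nat (2 * (j - 1) + 2))) =
      (\<Prod>j=1..i. (4 * c)\<^sup>2 * ((of_nat (2 * j + 1) * of_nat (2 * j)) * (of_nat (2 * j - 1) * of_nat (2 * j))))"
    proof (rule prod.cong)
      fix j assume "j \<in> {1..i}"
      then have e: "2 * (j - 1) + 1 = 2 * j - 1" "2 * (j - 1) + 2 = 2 * j" by auto
      show "(of_nat (2 * j + 1) * of_nat (2 * j) * (2 * c)\<^sup>2) * (4 * of_nat (2 * (j - 1) + 1) * of_nat (2 * (j - 1) + 2)) =
        (4 * c)\<^sup>2 * ((of_nat (2 * j + 1) * of_nat (2 * j)) * (of_nat (2 * j - 1) * of_nat (2 * j)))"
        unfolding e by (simp add: power2_eq_square)
    qed simp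
    also have "\<dots> = (4 * c) ^ (2 * i) * (fact (2 * i) * fact (2 * i + 1))"
      by (simp only: prod.distrib prod_fact_odd[symmetric] power_mult) simp
    finally show ?thesis .
  qed
  \<comment> \<open>Including \<open>fact 0 = 1\<close> allows an induction that appends two factors
    at a time.\<close>
  have "(\<Prod>r=1..2 * n - 1. fact r :: 'a) = (\<Prod>r<2 * n. fact r)"
    by (rule prod.mono_neutral_left) (auto simp: not_le less_Suc_eq_0_disj)
  moreover have "4 ^ n * (c ^ n * (\<Prod>i<n. (4 * c) ^ (2 * i) * (fact (2 * i) * fact (2 * i + 1)))) =
     (4 * c) ^ n\<^sup>2 * (\<Prod>r<2 * n. fact r :: 'a)"
  proof (induction n)
    case (Suc n)
    have "(Suc n)\<^sup>2 = n\<^sup>2 + (2 * n + 1)" by (simp add: power2_eq_square)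
    then have p: "(4 * c) ^ (Suc n)\<^sup>2 = (4 * c) ^ n\<^sup>2 * (4 * c) ^ (2 * n) * (4 * c)"
      by (simp only: power_add) simp
    have f: "(\<Prod>r<2 * Suc n. fact r :: 'a) = (\<Prod>r<2 * n. fact r) * fact (2 * n) * fact (2 * n + 1)"
      by (simp only: mult_Suc_right numeral_2_eq_2 add_Suc add_0 prod.lessThan_Suc) (simp add: mult.assoc)
    show ?case
      unfolding p f prod.lessThan_Suc power_Suc[of _ n]
      using arg_cong[OF Suc.IH, of "\<lambda>t. t * ((4 * c) * (4 * c) ^ (2 * n) * (fact (2 * n) * fact (2 * n + 1)))"]
      by (simp only: mult_ac)
  qed simp
  ultimately show ?thesis by (simp only: inner)
qed

text \<open>One factor 2 from \<open>2 ^ n\<close> goes to each inner product, as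
  \<open>prod_fact_even\<close> requires. The powers of \<open>c\<close> add up to
  \<open>2 n + n (n - 1) = n (n + 1)\<close>.\<close>

lemma prod_hankel_even:
  "2 ^ n * ((c\<^sup>2) ^ n * (\<Prod>i<n. \<Prod>j=1..i. (of_nat (2 * j + 2) * of_nat (2 * j + 1) * c\<^sup>2) *
       (of_nat (2 * (j - 1) + 2) * of_nat (2 * (j - 1) + 3)))) =
     c ^ (n * (n + 1)) * (\<Prod>r=1..2 * n. fact r :: 'a::field_char_0)"
proof -
  have inner: "2 * (\<Prod>j=1..i. (of_nat (2 * j + 2) * of_nat (2 * j + 1) * c\<^sup>2) *
       (of_nat (2 * (j - 1) + 2) * of_nat (2 * (j - 1) + 3))) = c ^ (2 * i) * (fact (2 * i + 1) * fact (2 * i + 2))" for i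
  proof -
    have "(\<Prod>j=1..i. (of_nat (2 * j + 2) * of_nat (2 * j + 1) * c\<^sup>2) *
       (of_nat (2 * (j - 1) + 2) * of_nat (2 * (j - 1) + 3))) =
      (\<Prod>j=1..i. c\<^sup>2 * ((of_nat (2 * j + 2) * of_nat (2 * j + 1)) * (of_nat (2 * j) * of_nat (2 * j + 1))))"
    proof (rule prod.cong)
      fix j assume "j \<in> {1..i}"
      then have e: "2 * (j - 1) + 3 = 2 * j + 1" "2 * (j - 1) + 2 = 2 * j" by auto
      show "(of_nat (2 * j + 2) * of_nat (2 * j + 1) * c\<^sup>2) * (of_nat (2 * (j - 1) + 2) * of_nat (2 * (j - 1) + 3)) =
        c\<^sup>2 * ((of_nat (2 * j + 2) * of_nat (2 * j + 1)) * (of_nat (2 * j) * of_nat (2 * j + 1)))"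
        unfolding e by (simp only: mult_ac)
    qed simp
    then show ?thesis
      by (simp only: prod.distrib prod_fact_even[symmetric] power_mult) simp
  qed
  have "(\<Prod>r=1..2 * n. fact r :: 'a) = (\<Prod>r<2 * n + 1. fact r)"
    by (rule prod.mono_neutral_left) (auto simp: not_le)
  moreover have "(c\<^sup>2) ^ n * (\<Prod>i<n. c ^ (2 * i) * (fact (2 * i + 1) * fact (2 * i + 2))) =
     c ^ (n * (n + 1)) * (\<Prod>r<2 * n + 1. fact r :: 'a)"
  proof (induction n)
    case (Suc n)
    have "Suc n * (Suc n + 1) = n * (n + 1) + (2 * n + 2)" by simp
    then have p: "c ^ (Suc n * (Suc n + 1)) = c ^ (n * (n + 1)) * c ^ (2 * n) * c\<^sup>2"
      by (simp only: power_add mult.assoc)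
    have "2 * Suc n + 1 = Suc (Suc (2 * n + 1))" by simp
    then have f: "(\<Prod>r<2 * Suc n + 1. fact r :: 'a) = (\<Prod>r<2 * n + 1. fact r) * fact (2 * n + 1) * fact (2 * n + 2)"
      by (simp only: prod.lessThan_Suc) (simp add: mult.assoc)
    show ?case
      unfolding p f prod.lessThan_Suc power_Suc[of _ n]
      using arg_cong[OF Suc.IH, of "\<lambda>t. t * (c\<^sup>2 * c ^ (2 * n) * (fact (2 * n + 1) * fact (2 * n + 2)))"]
      by (simp only: mult_ac)
  qed simp
  ultimately have eq: "(c\<^sup>2) ^ n * (\<Prod>i<n. c ^ (2 * i) * (fact (2 * i + 1) * fact (2 * i + 2))) =
     c ^ (n * (n + 1)) * (\<Prod>r=1..2 * n. fact r :: 'a)"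
    by (simp only:)
  define X where "X i = (\<Prod>j=1..i. (of_nat (2 * j + 2) * of_nat (2 * j + 1) * c\<^sup>2) *
       (of_nat (2 * (j - 1) + 2) * of_nat (2 * (j - 1) + 3)))" for i
  have "2 ^ n * ((c\<^sup>2) ^ n * (\<Prod>i<n. X i)) = (c\<^sup>2) ^ n * (\<Prod>i<n. 2 * X i)"
    by (simp add: prod.distrib mult_ac)
  also have "\<dots> = c ^ (n * (n + 1)) * (\<Prod>r=1..2 * n. fact r)"
    unfolding inner[folded X_def] by (rule eq)
  finally show ?thesis unfolding X_def .
qed

section \<open>The two Hankel determinants of Lambert series\<close>

context
  fixes q :: complex
  assumes q0: "q \<noteq> 0" and q1: "norm q < 1"
begin

private abbreviation F where "F \<equiv> moments (odd_part (lambert_weight q))"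

text \<open>The odd powers of \<open>F\<close> serve as basis, the \<open>(2 r + 1)\<close>-st
  derivatives at 0 as functional values. \<open>ode_power\<close> supplies the tridiagonal
  recurrence, and since \<open>F^(2 k + 1)\<close> has order at least \<open>2 k + 1\<close>, only
  \<open>k = 0\<close> starts with a nonzero value.\<close>

lemma det_lambert_C:
  "4 ^ n * det (mat n n (\<lambda>(i, j). lambert_C (2 * (i + j) + 1) q)) =
    (4 * lambert_C 1 q) ^ n\<^sup>2 * (\<Prod>r=1..2 * n - 1. fact r)"
proof -
  obtain \<alpha> where ode: "fps_deriv (fps_deriv F) = 8 * F ^ 3 + fps_const \<alpha> * F"
    using moments_odd_part_ode[OF q0 q1] by blast
  have F0: "fps_nth F 0 = 0" by (rule moments_odd_part_0[OF q0 q1])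
  have F1: "fps_nth F 1 = 2 * lambert_C 1 q" using moments_odd_part_nth[OF q0 q1, of 1] by simp
  note ode_pw = ode_power[OF ode F0 F1]
  \<comment> \<open>Halved because the derivatives of \<open>F\<close> are twice the Lambert
    series.\<close>
  define y where "y r k = fact (2 * r + 1) * fps_nth (F ^ (2 * k + 1)) (2 * r + 1) / 2" for r k
  have y0: "y 0 k = (if k = 0 then lambert_C 1 q else 0)" for k
    using F1 power_nth_less[OF F0, of 1 "2 * k + 1"] by (auto simp: y_def)
  have yS: "y (Suc r) k = (if k = 0 then 0 else (of_nat (2 * k + 1) * of_nat (2 * k) * (2 * lambert_C 1 q)\<^sup>2) * y r (k - 1)) +
      (of_nat (2 * k + 1) ^ 2 * \<alpha>) * y r k + (4 * of_nat (2 * k + 1) * of_nat (2 * k + 2)) * y r (Suc k)" for r k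
  proof -
    have e: "2 * Suc r + 1 = (2 * r + 1) + 2" by simp
    have "y (Suc r) k = fact (2 * r + 1) * fps_nth (fps_deriv (fps_deriv (F ^ (2 * k + 1)))) (2 * r + 1) / 2"
      unfolding y_def e fact_nth_deriv2 ..
    also have "\<dots> = (of_nat (2 * k + 1) * of_nat (2 * k) * (2 * lambert_C 1 q)\<^sup>2) *
        (fact (2 * r + 1) * fps_nth (F ^ (2 * k + 1 - 2)) (2 * r + 1) / 2) +
        (of_nat (2 * k + 1) ^ 2 * \<alpha>) * (fact (2 * r + 1) * fps_nth (F ^ (2 * k + 1)) (2 * r + 1) / 2) +
        (4 * of_nat (2 * k + 1) * of_nat (2 * k + 2)) * (fact (2 * r + 1) * fps_nth (F ^ (2 * k + 1 + 2)) (2 * r + 1) / 2)" (is "_ = ?R")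
      unfolding ode_pw fps_add_nth fps_mult_left_const_nth by (simp add: field_simps)
    finally have fin: "y (Suc r) k = ?R" .
    have e2: "2 * k + 1 + 2 = 2 * Suc k + 1" by simp
    show ?thesis
    proof (cases "k = 0")
      case True
      then show ?thesis using fin unfolding e2 by (simp add: y_def)
    next
      case False
      then have "2 * k + 1 - 2 = 2 * (k - 1) + 1" by simp
      then show ?thesis using fin False unfolding e2 y_def[symmetric] by (simp only: y_def[symmetric] if_False)
    qed
  qed
  have "y r 0 = lambert_C (2 * r + 1) q" for r
    using moments_odd_part_nth[OF q0 q1, of "2 * r + 1"] by (simp add: y_def)
  then have "det (mat n n (\<lambda>(i, j). lambert_C (2 * (i + j) + 1) q)) = det (mat n n (\<lambda>(i, j). y (i + j) 0))"
    by simp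
  then show ?thesis
    unfolding det_hankel_tridiagonal[of y, OF y0 yS] by (simp only: prod_hankel_odd)
qed

text \<open>The same argument on the even powers from \<open>F^2\<close> upwards. Starting at the
  second derivative avoids the unevaluated constant weight of \<open>F^2\<close>.\<close>

lemma det_lambert_D:
  "2 ^ n * det (mat n n (\<lambda>(i, j). lambert_D (2 * (i + j) + 3) (q\<^sup>2))) =
    lambert_C 1 q ^ (n * (n + 1)) * (\<Prod>r=1..2 * n. fact r)"
proof -
  obtain \<alpha> where ode: "fps_deriv (fps_deriv F) = 8 * F ^ 3 + fps_const \<alpha> * F"
    using moments_odd_part_ode[OF q0 q1] by blast
  have F0: "fps_nth F 0 = 0" by (rule moments_odd_part_0[OF q0 q1])
  have F1: "fps_nth F 1 = 2 * lambert_C 1 q" using moments_odd_part_nth[OF q0 q1, of 1] by simp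
  note ode_pw = ode_power[OF ode F0 F1]
  \<comment> \<open>The divisor is the factor \<open>2 ^ (n + 1)\<close> of
    \<open>moments_odd_part_square_nth\<close> at \<open>n = 2 * r + 2\<close>. Each step in
    \<open>r\<close> thereby divides by 4, which scales the operator accordingly.\<close>
  define y where "y r k = fact (2 * r + 2) * fps_nth (F ^ (2 * k + 2)) (2 * r + 2) / (2 * 4 ^ (r + 1))" for r k
  have F2: "fps_nth (F ^ 2) 2 = (2 * lambert_C 1 q)\<^sup>2"
    using F0 F1 by (simp add: power2_eq_square fps_mult_nth numeral_2_eq_2)
  have y0: "y 0 k = (if k = 0 then (lambert_C 1 q)\<^sup>2 else 0)" for k
  proof -
    have "y 0 k = fps_nth (F ^ (2 * k + 2)) 2 / 4"
    proof -
      have "2 * 0 + 2 = (2::nat)" by simp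
      then show ?thesis unfolding y_def by (simp only: fact_2) simp
    qed
    moreover have "fps_nth (F ^ (2 * k + 2)) 2 = 0" if "k \<noteq> 0"
      by (rule power_nth_less[OF F0]) (use that in simp)
    ultimately show ?thesis
      using F2 F2[unfolded power2_eq_square[of F]] by (cases "k = 0") (simp_all add: power_mult_distrib)
  qed
  have yS: "y (Suc r) k = (if k = 0 then 0 else (of_nat (2 * k + 2) * of_nat (2 * k + 1) * (lambert_C 1 q)\<^sup>2) * y r (k - 1)) +
      (of_nat (2 * k + 2) ^ 2 * \<alpha> / 4) * y r k + (of_nat (2 * k + 2) * of_nat (2 * k + 3)) * y r (Suc k)" for r k
  proof -
    have e: "2 * Suc r + 2 = (2 * r + 2) + 2" by simp
    have "y (Suc r) k = fact (2 * r + 2) * fps_nth (fps_deriv (fps_deriv (F ^ (2 * k + 2)))) (2 * r + 2) / (2 * 4 ^ (Suc r + 1))"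
      unfolding y_def e fact_nth_deriv2 ..
    also have "\<dots> = (of_nat (2 * k + 2) * of_nat (2 * k + 1) * (lambert_C 1 q)\<^sup>2) *
        (fact (2 * r + 2) * fps_nth (F ^ (2 * k + 2 - 2)) (2 * r + 2) / (2 * 4 ^ (r + 1))) +
        (of_nat (2 * k + 2) ^ 2 * \<alpha> / 4) * (fact (2 * r + 2) * fps_nth (F ^ (2 * k + 2)) (2 * r + 2) / (2 * 4 ^ (r + 1))) +
        (of_nat (2 * k + 2) * of_nat (2 * k + 3)) * (fact (2 * r + 2) * fps_nth (F ^ (2 * k + 2 + 2)) (2 * r + 2) / (2 * 4 ^ (r + 1)))" (is "_ = ?R")
    proof -
      have "2 * k + 2 - 1 = 2 * k + 1" "2 * k + 2 + 1 = 2 * k + 3" by simp_all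
      then show ?thesis
        unfolding ode_pw fps_add_nth fps_mult_left_const_nth
        by (simp only: power_mult_distrib power_Suc add_Suc) (simp add: field_simps)
    qed
    finally have fin: "y (Suc r) k = ?R" .
    have e2: "2 * k + 2 + 2 = 2 * Suc k + 2" by simp
    show ?thesis
    proof (cases "k = 0")
      case True
      then show ?thesis using fin unfolding e2 by (simp add: y_def)
    next
      case False
      then have "2 * k + 2 - 2 = 2 * (k - 1) + 2" by simp
      then show ?thesis using fin False unfolding e2 y_def[symmetric] by (simp only: y_def[symmetric] if_False)
    qed
  qed
  have "y r 0 = lambert_D (2 * r + 3) (q\<^sup>2)" for r
  proof -
    have m: "fact (2 * r + 2) * fps_nth (F ^ 2) (2 * r + 2) = 2 ^ (2 * r + 2 + 1) * lambert_D (2 * r + 2 + 1) (q\<^sup>2)"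
      by (rule moments_odd_part_square_nth[OF q0 q1]) auto
    have p: "(2::complex) ^ (2 * r + 2 + 1) = 2 * 4 ^ (r + 1)"
      by (simp add: power_mult)
    have e: "2 * r + 2 + 1 = 2 * r + 3" by simp
    have "y r 0 = 2 * 4 ^ (r + 1) * lambert_D (2 * r + 3) (q\<^sup>2) / (2 * 4 ^ (r + 1))"
      unfolding y_def mult_0_right add_0 m p unfolding e ..
    then show ?thesis by simp
  qed
  then have "det (mat n n (\<lambda>(i, j). lambert_D (2 * (i + j) + 3) (q\<^sup>2))) = det (mat n n (\<lambda>(i, j). y (i + j) 0))"
    by simp
  then show ?thesis
    unfolding det_hankel_tridiagonal[of y, OF y0 yS] by (simp only: prod_hankel_even)
qed

end

section \<open>Assembly of the theta powers, determinants and scalar factors\<close>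

theorem theorem5p11:
  fixes q :: complex and n :: nat
  assumes "0 < norm q" and "norm q < 1" and "n \<ge> 1"
  shows "theta2 q ^ (4 * n\<^sup>2) =
           (4 ^ (n * (n + 1)) * (\<Prod>r = 1..2 * n - 1. inverse (fact r))) *
           det (mat1 n (\<lambda>r s. lambert_C (2 * (r + s - 1) - 1) q)) \<and>
         (\<forall>p. p\<^sup>2 = q \<longrightarrow>
           theta2 p ^ (4 * n * (n + 1)) =
             (2 ^ (n * (4 * n + 5)) * (\<Prod>r = 1..2 * n. inverse (fact r))) *
             det (mat1 n (\<lambda>r s. lambert_D (2 * (r + s - 1) + 1) q)))"
proof (intro conjI allI impI)
  have q: "q \<noteq> 0" "norm q < 1" using assms by auto
  have inv: "(\<Prod>r\<in>A. inverse (fact r)) = inverse (\<Prod>r\<in>A. fact r :: complex)" for A :: "nat set"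
    using prod_inversef[of fact A] by (simp add: o_def)
  have ne: "(\<Prod>r\<in>A. fact r :: complex) \<noteq> 0" if "finite A" for A :: "nat set"
    using that by simp
  define P where "P = (\<Prod>r=1..2 * n - 1. fact r :: complex)"
  define C where "C = det (mat n n (\<lambda>(i, j). lambert_C (2 * (i + j) + 1) q))"
  \<comment> \<open>Passing from indices starting at 1 to indices starting at 0 turns
    \<open>2 * (r + s - 1) - 1\<close> into \<open>2 * (i + j) + 1\<close>.\<close>
  have "mat1 n (\<lambda>r s. lambert_C (2 * (r + s - 1) - 1) q) = mat n n (\<lambda>(i, j). lambert_C (2 * (i + j) + 1) q)"
    unfolding mat1_def by (intro cong_mat) auto
  \<comment> \<open>The factor 16 per fourth power is split as \<open>4 * 4\<close> to expose the
    \<open>4 * lambert_C 1 q\<close> of the determinant formula.\<close>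
  moreover have "theta2 q ^ (4 * n\<^sup>2) = 4 ^ n\<^sup>2 * (4 * lambert_C 1 q) ^ n\<^sup>2"
    unfolding theta2_power4[OF q] power_mult_distrib[symmetric] by simp
  moreover have "(4 * lambert_C 1 q) ^ n\<^sup>2 = 4 ^ n * C * inverse P"
    using det_lambert_C[OF q, of n] ne[of "{1..2 * n - 1}"] by (simp add: C_def P_def field_simps)
  moreover have "(4::complex) ^ (n * (n + 1)) = 4 ^ n\<^sup>2 * 4 ^ n"
    by (simp add: power2_eq_square power_add[symmetric] add.commute)
  ultimately show "theta2 q ^ (4 * n\<^sup>2) =
     (4 ^ (n * (n + 1)) * (\<Prod>r = 1..2 * n - 1. inverse (fact r))) *
     det (mat1 n (\<lambda>r s. lambert_C (2 * (r + s - 1) - 1) q))"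
    unfolding inv by (simp add: C_def P_def)
  \<comment> \<open>The determinant formula is now used at nome \<open>p\<close>: it involves
    \<open>lambert_C 1 p\<close> but the series \<open>lambert_D\<close> at
    \<open>p\<^sup>2 = q\<close>.\<close>
  fix p assume pq: "p\<^sup>2 = q"
  have p: "p \<noteq> 0" using q pq by auto
  have "norm p ^ 2 < 1" using q pq by (simp add: norm_power[symmetric])
  with p have p: "p \<noteq> 0" "norm p < 1" by (auto simp: power_less_one_iff)
  define P' where "P' = (\<Prod>r=1..2 * n. fact r :: complex)"
  define D where "D = det (mat n n (\<lambda>(i, j). lambert_D (2 * (i + j) + 3) q))"
  have "mat1 n (\<lambda>r s. lambert_D (2 * (r + s - 1) + 1) q) = mat n n (\<lambda>(i, j). lambert_D (2 * (i + j) + 3) q)"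
    unfolding mat1_def by (intro cong_mat) (auto simp: numeral_eq_Suc)
  moreover have "theta2 p ^ (4 * n * (n + 1)) = 2 ^ (4 * (n * (n + 1))) * lambert_C 1 p ^ (n * (n + 1))"
  proof -
    have "(16 * c) ^ m = 2 ^ (4 * m) * c ^ m" for c :: complex and m
      by (simp add: power_mult_distrib power_mult)
    then show ?thesis unfolding mult.assoc[of 4 n] theta2_power4[OF p] .
  qed
  moreover have "lambert_C 1 p ^ (n * (n + 1)) = 2 ^ n * D * inverse P'"
    using det_lambert_D[OF p, of n] ne[of "{1..2 * n}"] by (simp add: D_def P'_def field_simps pq)
  moreover have "(2::complex) ^ (n * (4 * n + 5)) = 2 ^ (4 * (n * (n + 1))) * 2 ^ n"
    unfolding power_add[symmetric] by (rule arg_cong[of _ _ "power 2"]) (simp add: algebra_simps)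
  ultimately show "theta2 p ^ (4 * n * (n + 1)) =
     (2 ^ (n * (4 * n + 5)) * (\<Prod>r = 1..2 * n. inverse (fact r))) *
     det (mat1 n (\<lambda>r s. lambert_D (2 * (r + s - 1) + 1) q))"
    unfolding inv by (simp add: D_def P'_def)
qed

end
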